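(* Let $\psi(x,z)$ be a Darboux transform of $e^{xz}$, with monic polynomials $f,g$ and monic operators $P,Q$ such that $\psi=\frac1{f(z)}Pe^{xz}$, $e^{xz}=\frac1{g(z)}Q\psi$ and $\mathrm{ord}\,P=\deg f$. Write $h(\partial)=f(\partial)g(\partial)=Q P$ in the form $$h(\partial)=\prod_{r=1}^n\prod_{j=0}^{n_r}(\partial-\lambda_r+j)^{m_{r,j}},$$ where the $\lambda_r$ are distinct, $\lambda_r-\lambda_s\notin\mathbb{Z}$ for $r\neq s$, the $m_{r,j}$ are nonnegative integers, and $m_{r,0}>0$. Let $$W_r=\mathrm{span}\{x^ke^{(\lambda_r-j)x}:0\le k\le m_{r,j}-1,\ 0\le j\le n_r\}.$$ Then $\psi$ is trigonometric (i.e. $P,Q\in\mathbb{C}(e^x)[\partial]$) if and only if $\ker P=\bigoplus_{r=1}^nK_r$, where each $K_r$ is a subspace of $W_r$ having a basis that is a union of sets of the form $$\Big\{\frac{1}{l!}\partial_y^l\Big(\sum_{j=0}^{n_r}\sum_{k=0}^{m_{r,j}-1}c_{r,k,j}\,y^k e^{(\lambda_r-j)x}\Big)\Big|_{y=x}\ :\ l=0,1,\dots,l_0\Big\},$$ for complex constants $c_{r,k,j}$, where $l_0=\max\{k:\ c_{r,k,j}\neq0\text{ for some }j\}$.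
   Context: Notation: $\partial=\frac{\partial}{\partial x}$. Darboux transform: a function $\psi(x,z)$ is a Darboux transform of $e^{xz}$ if there exist monic polynomials $f,g$ and monic differential operators $P,Q$ with $\psi=\frac1{f(z)}Pe^{xz}$, $e^{xz}=\frac1{g(z)}Q\psi$, and the order of $P$ equal to $\deg f$. Trigonometric: a Darboux transform is called trigonometric if $P$ and $Q$ have coefficients that are rational functions of $e^x$. *)

theory Defs
  imports "HOL-Analysis.Analysis" "HOL-Computational_Algebra.Polynomial"
begin

text \<open>Functions of x are complex functions; the operators act on a nonempty
open connected domain U of the complex plane.\<close>

definition dop :: "(nat \<Rightarrow> complex \<Rightarrow> complex) \<Rightarrow> nat \<Rightarrow> (complex \<Rightarrow> complex) \<Rightarrow> complex \<Rightarrow> complex" where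
  "dop a d u x = (deriv ^^ d) u x + (\<Sum>i<d. a i x * (deriv ^^ i) u x)"

definition darboux_psi :: "(nat \<Rightarrow> complex \<Rightarrow> complex) \<Rightarrow> nat \<Rightarrow> complex poly \<Rightarrow> complex \<Rightarrow> complex \<Rightarrow> complex" where
  "darboux_psi a d f z x = dop a d (\<lambda>s. exp (s * z)) x / poly f z"

text \<open>Darboux transform data: f, g monic, P (coeffs a, order d) and Q (coeffs b, order e)
  monic with holomorphic coefficients on U, ord P = deg f, psi = (1/f) P e^{xz} and
  e^{xz} = (1/g) Q psi (stated multiplied out by g(z), for all z with f(z) nonzero).\<close>
definition darboux_data ::
  "complex set \<Rightarrow> complex poly \<Rightarrow> complex poly \<Rightarrow> (nat \<Rightarrow> complex \<Rightarrow> complex) \<Rightarrow> nat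
     \<Rightarrow> (nat \<Rightarrow> complex \<Rightarrow> complex) \<Rightarrow> nat \<Rightarrow> bool" where
  "darboux_data U f g a d b e \<longleftrightarrow>
     lead_coeff f = 1 \<and> lead_coeff g = 1 \<and> d = degree f \<and>
     (\<forall>i<d. a i holomorphic_on U) \<and> (\<forall>i<e. b i holomorphic_on U) \<and>
     (\<forall>z. poly f z \<noteq> 0 \<longrightarrow>
        (\<forall>x\<in>U. dop b e (darboux_psi a d f z) x = poly g z * exp (x * z)))"

definition trig_coeffs :: "complex set \<Rightarrow> (nat \<Rightarrow> complex \<Rightarrow> complex) \<Rightarrow> nat \<Rightarrow> bool" where
  "trig_coeffs U a d \<longleftrightarrow>
     (\<forall>i<d. \<exists>p q :: complex poly. q \<noteq> 0 \<and>
        (\<forall>x\<in>U. poly q (exp x) \<noteq> 0 \<longrightarrow> a i x = poly p (exp x) / poly q (exp x)))"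

text \<open>A coefficient family c_{r,k,j} for fixed r, encoded as polynomials
  c j = sum_k c_{r,k,j} y^k, with k \<le> m_{r,j} - 1, j \<le> n_r, not all zero.\<close>
definition adm_coeffs :: "nat \<Rightarrow> (nat \<Rightarrow> nat) \<Rightarrow> (nat \<Rightarrow> complex poly) \<Rightarrow> bool" where
  "adm_coeffs N M c \<longleftrightarrow>
     (\<forall>j. N < j \<longrightarrow> c j = 0) \<and> (\<forall>j\<le>N. c j = 0 \<or> degree (c j) < M j) \<and> (\<exists>j\<le>N. c j \<noteq> 0)"

definition l0 :: "nat \<Rightarrow> (nat \<Rightarrow> complex poly) \<Rightarrow> nat" where
  "l0 N c = Max ((\<lambda>j. degree (c j)) ` {j. j \<le> N \<and> c j \<noteq> 0})"

definition block :: "complex \<Rightarrow> nat \<Rightarrow> (nat \<Rightarrow> complex poly) \<Rightarrow> (complex \<Rightarrow> complex) set" where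
  "block lam N c = {(\<lambda>x. \<Sum>j\<le>N. poly ((pderiv ^^ l) (c j)) x / fact l * exp ((lam - of_nat j) * x))
                    | l. l \<le> l0 N c}"

definition basis_union :: "complex \<Rightarrow> nat \<Rightarrow> (nat \<Rightarrow> complex poly) list \<Rightarrow> (complex \<Rightarrow> complex) set" where
  "basis_union lam N cs = (\<Union>c\<in>set cs. block lam N c)"

definition fspan :: "(complex \<Rightarrow> complex) set \<Rightarrow> (complex \<Rightarrow> complex) set" where
  "fspan B = {(\<lambda>x. \<Sum>b\<in>B. w b * b x) | w. True}"

definition lin_indep :: "(complex \<Rightarrow> complex) set \<Rightarrow> bool" where
  "lin_indep B \<longleftrightarrow> finite B \<and>
     (\<forall>w. (\<lambda>x. \<Sum>b\<in>B. w b * b x) = (\<lambda>x. 0) \<longrightarrow> (\<forall>b\<in>B. w b = 0))"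

definition ker_is_dsum ::
  "complex set \<Rightarrow> (nat \<Rightarrow> complex \<Rightarrow> complex) \<Rightarrow> nat \<Rightarrow> nat \<Rightarrow> (nat \<Rightarrow> (complex \<Rightarrow> complex) set) \<Rightarrow> bool" where
  "ker_is_dsum U a d n K \<longleftrightarrow>
     (\<forall>u. (u holomorphic_on U \<and> (\<forall>x\<in>U. dop a d u x = 0)) \<longleftrightarrow>
          (\<exists>v. (\<forall>r\<in>{1..n}. v r \<in> K r) \<and> (\<forall>x\<in>U. u x = (\<Sum>r=1..n. v r x)))) \<and>
     (\<forall>v. (\<forall>r\<in>{1..n}. v r \<in> K r) \<and> (\<forall>x\<in>U. (\<Sum>r=1..n. v r x) = 0) \<longrightarrow>
          (\<forall>r\<in>{1..n}. v r = (\<lambda>x. 0)))"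

end

theory Submission
  imports Defs "HOL-Complex_Analysis.Complex_Analysis" "HOL-Library.Function_Algebras"
    "Jordan_Normal_Form.Determinant"
begin

text \<open>The relation Q P = h(d/dx) puts ker P inside the space of quasi-polynomials annihilated by
  h(d/dx), and ker P determines P. If P has coefficients rational in exp x, then ker P is stable under
  translation by 2 pi i; since the numbers exp (2 pi i lam r) are distinct, it splits along r, and
  the unipotent part of the translation shows that each summand is stable under the nilpotent
  operator d/dy acting on the polynomial coefficients only. The required bases are exactly the
  Jordan bases of that operator. Conversely, stability under d/dy means stability under all shifts of
  y. At the point x the shift by -x makes the coefficients constant, so the linear system
  that determines P at x has coefficients polynomial in exp x, and Cramer's rule makes P
  trigonometric. Then so is Q, by comparing coefficients in Q P = h(d/dx).\<close>

text \<open>\<open>U\<close> is only open and connected: it need not be invariant under translation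
  by 2 pi i, nor simply connected, so the translation argument cannot be run on \<open>U\<close>
  itself. But kernel elements are restrictions of entire quasi-polynomials, and once a common
  denominator in exp x is cleared, P u = 0 becomes the vanishing of an entire function, which can be
  evaluated at every x + 2 pi i k. The outcome is a relation between sequences rho_r^k A_r(k) with
  distinct nonzero rho_r, which forces every A_r to vanish. Read as a polynomial in the shift s of
  the coefficients, A_r contains both facts wanted: its value at s = 0 gives the splitting, its
  derivative there gives stability under d/dy. In the other direction Cramer's rule needs a square
  system, hence dim ker P = ord P. On a domain with possible monodromy this is not a general fact
  about linear equations; it is drawn from the factorization of h(d/dx).\<close>

hide_const (open) Module.smult

subsection \<open>Linear differential operators\<close>

text \<open>Writes the leading coefficient 1 as an ordinary coefficient. It is 1 at every index from
  \<open>d\<close> on, so that its properties need no range condition; the sums stop at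
  \<open>d\<close>.\<close>

definition mcoef :: "(nat \<Rightarrow> complex \<Rightarrow> complex) \<Rightarrow> nat \<Rightarrow> nat \<Rightarrow> complex \<Rightarrow> complex" where
  "mcoef a d i = (if i < d then a i else (\<lambda>x. 1))"

lemma dop_eq_mcoef: "dop a d u x = (\<Sum>i\<le>d. mcoef a d i x * (deriv ^^ i) u x)"
  by (simp add: dop_def mcoef_def lessThan_Suc_atMost[symmetric])

lemma mcoef_holomorphic [holomorphic_intros]:
  assumes "\<forall>i<d. a i holomorphic_on U"
  shows "mcoef a d i holomorphic_on U"
  using assms by (auto simp: mcoef_def)

lemma higher_deriv_lin_comb:
  assumes "open U" "x \<in> U" "\<And>k. k \<in> A \<Longrightarrow> u k holomorphic_on U"
  shows "(deriv ^^ n) (\<lambda>x. \<Sum>k\<in>A. w k * u k x) x = (\<Sum>k\<in>A. w k * (deriv ^^ n) (u k) x)"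
  using assms(3)
proof (induction A rule: infinite_finite_induct)
  case (insert k A)
  have "(deriv ^^ n) (\<lambda>x. w k * u k x + (\<Sum>k\<in>A. w k * u k x)) x
      = (deriv ^^ n) (\<lambda>x. w k * u k x) x + (deriv ^^ n) (\<lambda>x. \<Sum>k\<in>A. w k * u k x) x"
    using insert assms by (intro higher_deriv_add[where S = U] holomorphic_intros) auto
  also have "(deriv ^^ n) (\<lambda>x. w k * u k x) x = w k * (deriv ^^ n) (u k) x"
    using insert assms by (intro higher_deriv_cmult[where A = U]) auto
  finally show ?case using insert by simp
qed simp_all

lemma dop_holomorphic:
  assumes "open U" "u holomorphic_on U" "\<forall>i<d. a i holomorphic_on U"
  shows "dop a d u holomorphic_on U"
  unfolding dop_eq_mcoef[abs_def] using assms by (auto intro!: holomorphic_intros)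

lemma dop_cong:
  assumes "open U" "x \<in> U" "u holomorphic_on U" "\<And>y. y \<in> U \<Longrightarrow> u y = v y"
  shows "dop a d u x = dop a d v x"
proof -
  have "v holomorphic_on U" using assms holomorphic_cong by blast
  then have "(deriv ^^ i) u x = (deriv ^^ i) v x" for i
    using assms higher_deriv_transform_within_open by blast
  then show ?thesis by (simp add: dop_def)
qed

lemma dop_lin_comb:
  assumes "open U" "x \<in> U" "\<And>k. k \<in> A \<Longrightarrow> u k holomorphic_on U"
  shows "dop a d (\<lambda>x. \<Sum>k\<in>A. w k * u k x) x = (\<Sum>k\<in>A. w k * dop a d (u k) x)"
proof -
  have "dop a d (\<lambda>x. \<Sum>k\<in>A. w k * u k x) x
      = (\<Sum>i\<le>d. \<Sum>k\<in>A. w k * (mcoef a d i x * (deriv ^^ i) (u k) x))"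
    unfolding dop_eq_mcoef using higher_deriv_lin_comb[OF assms(1,2), of A u] assms(3)
    by (simp add: sum_distrib_left mult_ac)
  also have "\<dots> = (\<Sum>k\<in>A. w k * dop a d (u k) x)"
    unfolding dop_eq_mcoef sum_distrib_left by (rule sum.swap)
  finally show ?thesis .
qed

lemma dop_cmult:
  assumes "open U" "x \<in> U" "u holomorphic_on U"
  shows "dop a d (\<lambda>x. c * u x) x = c * dop a d u x"
  using dop_lin_comb[of U x "{0::nat}" "\<lambda>_. u" a d "\<lambda>_. c"] assms by simp

section \<open>Polynomials in d/dx and the symbol of a composition\<close>

definition poly_diff_op :: "complex poly \<Rightarrow> (complex \<Rightarrow> complex) \<Rightarrow> complex \<Rightarrow> complex" where
  "poly_diff_op h u x = (\<Sum>k\<le>degree h. coeff h k * (deriv ^^ k) u x)"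

lemma pop_eq_bound:
  assumes "degree h \<le> K"
  shows "poly_diff_op h u x = (\<Sum>k\<le>K. coeff h k * (deriv ^^ k) u x)"
  unfolding poly_diff_op_def using assms by (intro sum.mono_neutral_left) (auto simp: coeff_eq_0)

lemma pop_add: "poly_diff_op (g + h) u x = poly_diff_op g u x + poly_diff_op h u x"
proof -
  define K where "K = max (degree g) (degree h)"
  have "degree (g + h) \<le> K" unfolding K_def by (rule degree_add_le_max)
  then show ?thesis
    using pop_eq_bound[of "g + h" K] pop_eq_bound[of g K] pop_eq_bound[of h K]
    by (simp add: K_def sum.distrib algebra_simps)
qed

lemma pop_0 [simp]: "poly_diff_op 0 u x = 0"
  by (simp add: poly_diff_op_def)

lemma pop_sum: "poly_diff_op (\<Sum>i\<in>A. h i) u x = (\<Sum>i\<in>A. poly_diff_op (h i) u x)"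
  by (induction A rule: infinite_finite_induct) (auto simp: pop_add)

lemma pop_monom: "poly_diff_op (monom c k) u x = c * (deriv ^^ k) u x"
proof -
  have "poly_diff_op (monom c k) u x = (\<Sum>i\<le>k. if i = k then c * (deriv ^^ k) u x else 0)"
    unfolding pop_eq_bound[OF degree_monom_le] by (intro sum.cong) auto
  then show ?thesis by simp
qed

lemma higher_deriv_exp_mult: "(deriv ^^ k) (\<lambda>s. exp (s * z)) = (\<lambda>s. z ^ k * exp (s * (z::complex)))"
proof (induction k)
  case (Suc k)
  have "deriv (\<lambda>s. z ^ k * exp (s * z)) s = z ^ Suc k * exp (s * z)" for s
    by (rule DERIV_imp_deriv) (auto intro!: derivative_eq_intros)
  then show ?case using Suc by simp
qed simp

lemma pop_exp: "poly_diff_op h (\<lambda>s. exp (s * z)) x = poly h z * exp (x * z)"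
  unfolding poly_diff_op_def higher_deriv_exp_mult poly_altdef sum_distrib_right by (simp add: mult.assoc)

text \<open>Leibniz's rule: D^j (a_i D^i) is the sum over t of C(j,t) a_i^(j-t) D^(i+t). This is the
  full symbol of Q P frozen at \<open>x\<close>, an ordinary polynomial in D, so
  \<open>poly_diff_op\<close> can evaluate it at that one point.\<close>

definition comp_symbol ::
  "(nat \<Rightarrow> complex \<Rightarrow> complex) \<Rightarrow> nat \<Rightarrow> (nat \<Rightarrow> complex \<Rightarrow> complex) \<Rightarrow> nat \<Rightarrow> complex \<Rightarrow> complex poly" where
  "comp_symbol b e a d x = (\<Sum>j\<le>e. \<Sum>i\<le>d. \<Sum>t\<le>j.
     monom (mcoef b e j x * of_nat (j choose t) * (deriv ^^ (j - t)) (mcoef a d i) x) (i + t))"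

lemma dop_dop:
  assumes "open U" "x \<in> U" "u holomorphic_on U" "\<forall>i<d. a i holomorphic_on U"
  shows "dop b e (dop a d u) x = poly_diff_op (comp_symbol b e a d x) u x"
proof -
  have 1: "(deriv ^^ j) (dop a d u) x
     = (\<Sum>i\<le>d. \<Sum>t\<le>j. of_nat (j choose t) * (deriv ^^ (j - t)) (mcoef a d i) x * (deriv ^^ (i + t)) u x)" for j
  proof -
    have "(deriv ^^ j) (dop a d u) x
       = (deriv ^^ j) (\<lambda>x. \<Sum>i\<le>d. 1 * (\<lambda>x. (deriv ^^ i) u x * mcoef a d i x) x) x"
      by (simp add: dop_eq_mcoef[abs_def] mult_ac)
    also have "\<dots> = (\<Sum>i\<le>d. 1 * (deriv ^^ j) (\<lambda>x. (deriv ^^ i) u x * mcoef a d i x) x)"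
      using assms by (intro higher_deriv_lin_comb[where U = U]) (auto intro!: holomorphic_intros)
    also have "\<dots> = (\<Sum>i\<le>d. \<Sum>t = 0..j. of_nat (j choose t) * (deriv ^^ t) ((deriv ^^ i) u) x
        * (deriv ^^ (j - t)) (mcoef a d i) x)"
      using assms by (intro sum.cong refl, simp, intro higher_deriv_mult[where S = U])
        (auto intro!: holomorphic_intros)
    also have "\<dots> = (\<Sum>i\<le>d. \<Sum>t\<le>j. of_nat (j choose t) * (deriv ^^ (j - t)) (mcoef a d i) x * (deriv ^^ (i + t)) u x)"
    proof -
      have "(deriv ^^ t) ((deriv ^^ i) u) = (deriv ^^ (i + t)) u" for t i
        by (simp add: add.commute[of i t] funpow_add)
      then show ?thesis by (intro sum.cong) (auto simp: mult_ac)
    qed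
    finally show ?thesis .
  qed
  show ?thesis
    unfolding dop_eq_mcoef[of b e] 1 comp_symbol_def pop_sum pop_monom sum_distrib_left
    by (simp add: mult_ac)
qed

lemma dop_exp_holomorphic:
  assumes "open U" "\<forall>i<d. a i holomorphic_on U"
  shows "dop a d (\<lambda>s. exp (s * z)) holomorphic_on U"
  using assms by (intro dop_holomorphic) (auto intro!: holomorphic_intros)

text \<open>Applied to exp (s z), Q P returns its symbol at z times the exponential, while the
  Darboux relations return f(z) g(z) times it. Comparison as polynomials in z shows that Q P has
  constant coefficients, although P and Q need not.\<close>

lemma darboux_symbol:
  assumes U: "open U" and D: "darboux_data U f g a d b e" and x: "x \<in> U"
  shows "comp_symbol b e a d x = f * g"
proof -
  have a: "\<forall>i<d. a i holomorphic_on U" and f: "f \<noteq> 0" using D by (auto simp: darboux_data_def)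
  have "poly (comp_symbol b e a d x) z = poly (f * g) z" if z: "poly f z \<noteq> 0" for z
  proof -
    have "dop b e (darboux_psi a d f z) x = dop b e (\<lambda>x. inverse (poly f z) * dop a d (\<lambda>s. exp (s * z)) x) x"
      by (simp add: darboux_psi_def[abs_def] field_simps)
    also have "\<dots> = inverse (poly f z) * dop b e (dop a d (\<lambda>s. exp (s * z))) x"
      by (rule dop_cmult[OF U x dop_exp_holomorphic[OF U a]])
    also have "dop b e (dop a d (\<lambda>s. exp (s * z))) x = poly (comp_symbol b e a d x) z * exp (x * z)"
      using dop_dop[OF U x _ a, of "\<lambda>s. exp (s * z)"] by (simp add: pop_exp holomorphic_intros)
    finally have "poly g z * exp (x * z) = inverse (poly f z) * (poly (comp_symbol b e a d x) z * exp (x * z))"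
      using D x z unfolding darboux_data_def by (metis (no_types, lifting))
    then show ?thesis using z by (simp add: field_simps)
  qed
  \<comment> \<open>The Darboux relations say nothing at the zeros of \<open>f\<close>; the extra
    factor \<open>f\<close> makes the identity hold at all z.\<close>
  then have "poly ((comp_symbol b e a d x - f * g) * f) z = 0" for z
    by (cases "poly f z = 0") auto
  then have "(comp_symbol b e a d x - f * g) * f = 0"
    by (metis poly_all_0_iff_0)
  with f show ?thesis by simp
qed

lemma darboux_comp:
  assumes U: "open U" and D: "darboux_data U f g a d b e" and "x \<in> U" "u holomorphic_on U"
  shows "dop b e (dop a d u) x = poly_diff_op (f * g) u x"
  using dop_dop[OF U] darboux_symbol[OF U D] assms by (simp add: darboux_data_def)

text \<open>A term b_j D^j of Q reaches at most order d + j in Q P, so only j \<ge> k contributes to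
  order d + k, and j = k contributes b_k alone because P is monic. This triangular shape yields the
  order of Q P and, later, the coefficients of Q.\<close>

lemma coeff_comp_symbol:
  assumes "k \<le> e"
  shows "coeff (comp_symbol b e a d x) (d + k) = mcoef b e k x + (\<Sum>j\<in>{k<..e}. \<Sum>i\<le>d. \<Sum>t\<le>j.
     if i + t = d + k then mcoef b e j x * of_nat (j choose t) * (deriv ^^ (j - t)) (mcoef a d i) x else 0)"
proof -
  define F where "F j i t = (if i + t = d + k then mcoef b e j x * of_nat (j choose t) * (deriv ^^ (j - t)) (mcoef a d i) x else 0)" for j i t
  have 1: "(\<Sum>i\<le>d. \<Sum>t\<le>k. F k i t) = mcoef b e k x"
  proof -
    have "(\<Sum>i\<le>d. \<Sum>t\<le>k. F k i t) = (\<Sum>i\<le>d. \<Sum>t\<le>k. if i = d then (if t = k then mcoef b e k x else 0) else 0)"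
      by (intro sum.cong refl) (auto simp: F_def mcoef_def)
    also have "\<dots> = (\<Sum>i\<le>d. if i = d then (\<Sum>t\<le>k. if t = k then mcoef b e k x else 0) else 0)"
      by (intro sum.cong) auto
    also have "\<dots> = mcoef b e k x" by simp
    finally show ?thesis .
  qed
  have 0: "(\<Sum>i\<le>d. \<Sum>t\<le>j. F j i t) = 0" if "j < k" for j
    using that by (intro sum.neutral ballI) (auto simp: F_def)
  have "coeff (comp_symbol b e a d x) (d + k) = (\<Sum>j\<le>e. \<Sum>i\<le>d. \<Sum>t\<le>j. F j i t)"
    by (simp add: comp_symbol_def coeff_sum F_def)
  also have "\<dots> = (\<Sum>j\<in>{k..e}. \<Sum>i\<le>d. \<Sum>t\<le>j. F j i t)"
    by (rule sum.mono_neutral_right) (auto simp: 0)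
  also have "{k..e} = insert k {k<..e}" using assms by auto
  finally show ?thesis using 1 by (simp add: F_def)
qed

lemma degree_comp_symbol: "degree (comp_symbol b e a d x) = d + e"
proof (rule antisym)
  show "degree (comp_symbol b e a d x) \<le> d + e"
    unfolding comp_symbol_def
    by (intro degree_sum_le finite_atMost order_trans[OF degree_monom_le]) auto
  have "coeff (comp_symbol b e a d x) (d + e) = 1"
    by (subst coeff_comp_symbol) (auto simp: mcoef_def)
  then show "d + e \<le> degree (comp_symbol b e a d x)" by (intro le_degree) auto
qed

lemma darboux_degree:
  assumes "open U" "U \<noteq> {}" "darboux_data U f g a d b e"
  shows "degree (f * g) = d + e"
proof -
  obtain x where "x \<in> U" using assms by auto
  then show ?thesis using darboux_symbol[OF assms(1,3)] degree_comp_symbol by metis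
qed

text \<open>D^k P is monic of order d + k, so applying it to u expresses the derivative of order d +
  k at \<open>x0\<close> through lower ones. Hence all derivatives vanish at \<open>x0\<close>, and
  the identity theorem finishes.\<close>

lemma dop_jet_unique:
  assumes U: "open U" "connected U" and a: "\<forall>i<d. a i holomorphic_on U"
    and u: "u holomorphic_on U" "\<And>x. x \<in> U \<Longrightarrow> dop a d u x = 0"
    and x0: "x0 \<in> U" "\<And>i. i < d \<Longrightarrow> (deriv ^^ i) u x0 = 0" and x: "x \<in> U"
  shows "u x = 0"
proof (rule holomorphic_fun_eq_0_on_connected[OF u(1) U _ x0(1) x])
  fix n show "(deriv ^^ n) u x0 = 0"
  proof (induction n rule: less_induct)
    case (less n)
    show ?case
    proof (cases "n < d")
      case False
      define k where "k = n - d"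
      then have n: "n = d + k" using False by simp
      \<comment> \<open>With zero lower coefficients, \<open>dop ek k\<close> is D^k.\<close>
      define ek where "ek = (\<lambda>(i::nat) (x::complex). 0 :: complex)"
      have "(deriv ^^ i) (\<lambda>_. 0 :: complex) = (\<lambda>_. 0)" for i
        by (induction i) auto
      then have "dop ek k (\<lambda>_. 0) x0 = 0" by (simp add: dop_def ek_def)
      then have 0: "dop ek k (dop a d u) x0 = 0"
        using dop_cong[OF U(1) x0(1), of "dop a d u" "\<lambda>_. 0" ek k] u dop_holomorphic[OF U(1) u(1) a]
        by simp
      have "poly_diff_op (comp_symbol ek k a d x0) u x0 = (\<Sum>i\<le>d + k. coeff (comp_symbol ek k a d x0) i * (deriv ^^ i) u x0)"
        by (simp add: poly_diff_op_def degree_comp_symbol)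
      also have "\<dots> = (\<Sum>i\<in>{d + k}. coeff (comp_symbol ek k a d x0) i * (deriv ^^ i) u x0)"
        using less n by (intro sum.mono_neutral_right) auto
      also have "\<dots> = (deriv ^^ n) u x0"
        by (simp add: n coeff_comp_symbol mcoef_def)
      finally show ?thesis using 0 dop_dop[OF U(1) x0(1) u(1) a, of ek k] by simp
    qed (use x0 in auto)
  qed
qed

subsection \<open>Quasi-polynomials\<close>

lemma pcompose_shift_top:
  fixes p :: "complex poly"
  shows "degree (p \<circ>\<^sub>p [:c, 1:]) = degree p" "coeff (p \<circ>\<^sub>p [:c, 1:]) (degree p) = lead_coeff p"
proof -
  show "degree (p \<circ>\<^sub>p [:c, 1:]) = degree p" by (simp add: degree_pcompose)
  then show "coeff (p \<circ>\<^sub>p [:c, 1:]) (degree p) = lead_coeff p"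
    using lead_coeff_comp[of "[:c, 1:]" p] by simp
qed

lemma poly_eq_0_if_nat_roots:
  fixes p :: "complex poly"
  assumes "\<And>k::nat. poly p (of_nat k) = 0"
  shows "p = 0"
proof (rule ccontr)
  assume "p \<noteq> 0"
  then have "finite {z. poly p z = 0}" by (rule poly_roots_finite)
  then have "finite (range (of_nat :: nat \<Rightarrow> complex))"
    by (rule finite_subset[rotated]) (use assms in auto)
  then show False using finite_imageD[of "of_nat :: nat \<Rightarrow> complex" UNIV] by (simp add: inj_of_nat)
qed

text \<open>The operator shift minus rho r0 lowers the degree of the r0-component and is injective on
  the others, which drives the inner induction.\<close>
lemma exp_poly_sequence_eq_0:
  fixes A :: "'i \<Rightarrow> complex poly" and rho :: "'i \<Rightarrow> complex"
  assumes "finite R" "inj_on rho R" "\<And>r. r \<in> R \<Longrightarrow> rho r \<noteq> 0"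
    and "\<And>k::nat. (\<Sum>r\<in>R. rho r ^ k * poly (A r) (of_nat k)) = 0" and "r \<in> R"
  shows "A r = 0"
proof -
  have "\<forall>r\<in>R. A r = 0" using assms(1-4)
  proof (induction R arbitrary: A rule: finite_induct)
    case (insert r0 R)
    \<comment> \<open>Zero has to rank below the nonzero constants, which the degree alone does not
      achieve.\<close>
    define meas where "meas A = (if A r0 = 0 then 0 else Suc (degree (A r0)))" for A :: "'i \<Rightarrow> complex poly"
    have *: "A r0 = 0 \<and> (\<forall>r\<in>R. A r = 0)" if "\<And>k::nat. (\<Sum>r\<in>insert r0 R. rho r ^ k * poly (A r) (of_nat k)) = 0" for A
      using that
    proof (induction "meas A" arbitrary: A rule: less_induct)
      case less
      show ?case
      proof (cases "A r0 = 0")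
        case True
        then have "\<And>k::nat. (\<Sum>r\<in>R. rho r ^ k * poly (A r) (of_nat k)) = 0"
          using less.prems insert by simp
        then show ?thesis using insert True by auto
      next
        case False
        define A' where "A' r = smult (rho r) (A r \<circ>\<^sub>p [:1, 1:]) - smult (rho r0) (A r)" for r
        have "A' r0 = smult (rho r0) (A r0 \<circ>\<^sub>p [:1, 1:] - A r0)"
          by (simp add: A'_def smult_diff_right)
        then have dd: "A' r0 = 0 \<or> degree (A' r0) < degree (A r0)"
        proof -
          assume A': "A' r0 = smult (rho r0) (A r0 \<circ>\<^sub>p [:1, 1:] - A r0)"
          let ?D = "A r0 \<circ>\<^sub>p [:1, 1:] - A r0"
          have "degree ?D \<le> degree (A r0)"
            by (rule degree_diff_le) (auto simp: pcompose_shift_top)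
          moreover have "coeff ?D (degree (A r0)) = 0" by (simp add: pcompose_shift_top)
          ultimately have "?D = 0 \<or> degree ?D < degree (A r0)"
            by (metis degree_0 le_neq_implies_less leading_coeff_0_iff)
          then show ?thesis using A' by auto
        qed
        have "(\<Sum>r\<in>insert r0 R. rho r ^ k * poly (A' r) (of_nat k)) = 0" for k
        proof -
          have "(\<Sum>r\<in>insert r0 R. rho r ^ k * poly (A' r) (of_nat k))
             = (\<Sum>r\<in>insert r0 R. rho r ^ Suc k * poly (A r) (of_nat (Suc k)) -
                  rho r0 * (rho r ^ k * poly (A r) (of_nat k)))"
            by (intro sum.cong) (auto simp: A'_def poly_pcompose algebra_simps)
          also have "\<dots> = (\<Sum>r\<in>insert r0 R. rho r ^ Suc k * poly (A r) (of_nat (Suc k))) -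
                  rho r0 * (\<Sum>r\<in>insert r0 R. rho r ^ k * poly (A r) (of_nat k))"
            by (simp only: sum_subtractf sum_distrib_left)
          finally show ?thesis by (simp only: less.prems) simp
        qed
        moreover have "meas A' < meas A" using dd False by (auto simp: meas_def)
        ultimately have A'0: "A' r = 0" if "r \<in> R" for r using less.hyps that by blast
        have R0: "A r = 0" if r: "r \<in> R" for r
        proof -
          have "coeff (A' r) (degree (A r)) = (rho r - rho r0) * lead_coeff (A r)"
            by (simp add: A'_def pcompose_shift_top algebra_simps)
          moreover have "rho r \<noteq> rho r0" using insert r by (auto simp: inj_on_def)
          ultimately show ?thesis using A'0[OF r] by auto
        qed
        have "poly (A r0) (of_nat k) = 0" for k :: nat
          using less.prems[of k] insert R0 by simp
        then have "A r0 = 0" by (rule poly_eq_0_if_nat_roots)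
        with R0 show ?thesis by auto
      qed
    qed
    show ?case using *[OF insert.prems(3)] by auto
  qed auto
  then show ?thesis using assms by auto
qed

text \<open>Indexed by \<open>I\<close> rather than by the frequencies: the same definition serves
  one class (indices j) and the whole spectrum (pairs (r, j)).\<close>

definition quasi_poly :: "'i set \<Rightarrow> ('i \<Rightarrow> complex) \<Rightarrow> ('i \<Rightarrow> complex poly) \<Rightarrow> complex \<Rightarrow> complex" where
  "quasi_poly I \<mu> p x = (\<Sum>i\<in>I. poly (p i) x * exp (\<mu> i * x))"

text \<open>Conjugation of d/dx by exp (c x): (p exp (c x))' = (p' + c p) exp (c x).\<close>

definition twisted_pderiv :: "complex \<Rightarrow> complex poly \<Rightarrow> complex poly" where
  "twisted_pderiv c p = pderiv p + smult c p"

lemma qp_holomorphic [holomorphic_intros]: "quasi_poly I \<mu> p holomorphic_on S"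
  unfolding quasi_poly_def[abs_def] by (intro holomorphic_intros) 

lemma qp_cong: "(\<And>i. i \<in> I \<Longrightarrow> p i = q i) \<Longrightarrow> quasi_poly I \<mu> p = quasi_poly I \<mu> q"
  by (auto simp: quasi_poly_def intro!: sum.cong)

lemma qp_0 [simp]: "quasi_poly I \<mu> (\<lambda>i. 0) = (\<lambda>x. 0)"
  by (auto simp: quasi_poly_def)

lemma qp_lin_comb:
  "(\<Sum>k\<in>A. w k * quasi_poly I \<mu> (p k) x) = quasi_poly I \<mu> (\<lambda>i. \<Sum>k\<in>A. smult (w k) (p k i)) x"
  unfolding quasi_poly_def sum_distrib_left poly_sum sum_distrib_right
  by (subst sum.swap) (simp add: mult_ac)

lemma qp_add: "quasi_poly I \<mu> p x + quasi_poly I \<mu> q x = quasi_poly I \<mu> (\<lambda>i. p i + q i) x"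
  by (simp add: quasi_poly_def sum.distrib algebra_simps)

lemma qp_diff: "quasi_poly I \<mu> p x - quasi_poly I \<mu> q x = quasi_poly I \<mu> (\<lambda>i. p i - q i) x"
  by (simp add: quasi_poly_def sum_subtractf algebra_simps)

lemma qp_smult: "c * quasi_poly I \<mu> p x = quasi_poly I \<mu> (\<lambda>i. smult c (p i)) x"
  by (simp add: quasi_poly_def sum_distrib_left algebra_simps)

lemma deriv_qp: "deriv (quasi_poly I \<mu> p) x = quasi_poly I \<mu> (\<lambda>i. twisted_pderiv (\<mu> i) (p i)) x"
  unfolding quasi_poly_def[abs_def]
  by (rule DERIV_imp_deriv)
     (auto intro!: derivative_eq_intros sum.cong poly_DERIV simp: twisted_pderiv_def algebra_simps)

lemma higher_deriv_qp: "(deriv ^^ k) (quasi_poly I \<mu> p) x = quasi_poly I \<mu> (\<lambda>i. (twisted_pderiv (\<mu> i) ^^ k) (p i)) x"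
proof (induction k arbitrary: x)
  case (Suc k)
  then have "(deriv ^^ k) (quasi_poly I \<mu> p) = quasi_poly I \<mu> (\<lambda>i. (twisted_pderiv (\<mu> i) ^^ k) (p i))" by blast
  then show ?case by (simp add: deriv_qp)
qed simp

section \<open>Identity theorem and uniqueness of the quasi-polynomial form\<close>

lemma holomorphic_eq_0_if_open_zeros:
  assumes f: "f holomorphic_on S" "open S" "connected S"
    and U: "open U" "U \<noteq> {}" "U \<subseteq> S" "\<And>x. x \<in> U \<Longrightarrow> f x = 0" and x: "x \<in> S"
  shows "f x = (0::complex)"
proof -
  obtain z where z: "z \<in> U" using U by auto
  have "(deriv ^^ n) (\<lambda>_. 0 :: complex) = (\<lambda>_. 0)" for n
    by (induction n) auto
  moreover have "(deriv ^^ n) f z = (deriv ^^ n) (\<lambda>_. 0) z" for n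
    using f U z by (intro higher_deriv_transform_within_open[where S = U])
      (auto intro!: holomorphic_intros intro: holomorphic_on_subset)
  ultimately have "(deriv ^^ n) f z = 0" for n by simp
  then show ?thesis using holomorphic_fun_eq_0_on_connected[OF f, of z x] z U x by auto
qed

lemma entire_eq_0:
  assumes "f holomorphic_on UNIV" "open U" "U \<noteq> {}" "\<And>x. x \<in> U \<Longrightarrow> f x = 0"
  shows "f x = (0::complex)"
  using holomorphic_eq_0_if_open_zeros[OF assms(1) open_UNIV connected_UNIV assms(2,3)] assms(4) by simp

text \<open>Sampling at the multiples of a small h > 0 keeps the numbers exp (h mu) distinct.\<close>
lemma qp_eq_0_imp:
  assumes I: "finite I" "inj_on \<mu> I" and U: "open U" "U \<noteq> {}"
    and 0: "\<And>x. x \<in> U \<Longrightarrow> quasi_poly I \<mu> p x = 0" and i: "i \<in> I"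
  shows "p i = 0"
proof -
  \<comment> \<open>The sample points used below need not lie in \<open>U\<close>.\<close>
  have 0: "quasi_poly I \<mu> p x = 0" for x
    using entire_eq_0[OF qp_holomorphic U 0] .
  \<comment> \<open>\<open>B\<close> bounds the norm of every \<mu> i, so h \<mu> i and h \<mu> j
    differ by at most 2 < 2 pi, and exp separates points that close. The summand 1 keeps
    \<open>B\<close> positive when all frequencies are 0.\<close>
  define B where "B = 1 + (\<Sum>i\<in>I. norm (\<mu> i))"
  have B: "B > 0" "norm (\<mu> i) \<le> B" if "i \<in> I" for i
    using member_le_sum[OF that, of "\<lambda>i. norm (\<mu> i)"] I by (auto simp: B_def intro!: add_pos_nonneg sum_nonneg)
  define h where "h = 1 / B"
  have h: "h > 0" using B i by (auto simp: h_def)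
  have inj: "inj_on (\<lambda>i. exp (\<mu> i * h)) I"
  proof (rule inj_onI)
    fix i j assume ij: "i \<in> I" "j \<in> I" "exp (\<mu> i * h) = exp (\<mu> j * h)"
    have "\<bar>Im (\<mu> i * h) - Im (\<mu> j * h)\<bar> \<le> norm ((\<mu> i - \<mu> j) * h)"
      using abs_Im_le_cmod[of "(\<mu> i - \<mu> j) * h"] by (simp add: algebra_simps)
    also have "\<dots> = norm (\<mu> i - \<mu> j) * h" using h by (simp add: norm_mult)
    also have "\<dots> \<le> (B + B) * h"
      using h B(2)[OF ij(1)] B(2)[OF ij(2)] norm_triangle_ineq4[of "\<mu> i" "\<mu> j"]
      by (intro mult_right_mono) auto
    also have "\<dots> = 2" using B(1)[OF i] by (simp add: h_def field_simps)
    also have "\<dots> < 2 * pi" using pi_gt3 by simp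
    finally have "\<mu> i * h = \<mu> j * h" using ij(3) exp_complex_eqI by blast
    then show "i = j" using h ij I by (auto simp: inj_on_def)
  qed
  have "(\<Sum>i\<in>I. exp (\<mu> i * h) ^ k * poly (p i \<circ>\<^sub>p [:0, of_real h:]) (of_nat k)) = 0" for k
    using 0[of "of_real h * of_nat k"]
    by (simp add: quasi_poly_def poly_pcompose exp_of_nat_mult[symmetric] mult_ac)
  then have "p i \<circ>\<^sub>p [:0, of_real h:] = 0"
    using exp_poly_sequence_eq_0[OF I(1) inj, of "\<lambda>i. p i \<circ>\<^sub>p [:0, of_real h:]"] i by simp
  then show ?thesis using h by (simp add: pcompose_eq_0_iff)
qed

text \<open>Solving q' + c q = p raises the degree only in the resonant case c = 0, where it is
  integration; this exact bound is what accounts for multiplicities. The last clause keeps absent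
  components absent.\<close>

lemma ex_tw_eq:
  shows "\<exists>q. twisted_pderiv c q = p \<and> (q = 0 \<or> degree q < Suc (degree p) + (if c = 0 then 1 else 0)) \<and> (p = 0 \<longrightarrow> q = 0)"
proof (cases "c = 0")
  case True
  define q where "q = (\<Sum>i\<le>degree p. monom (coeff p i / of_nat (Suc i)) (Suc i))"
  have "pderiv q = (\<Sum>i\<le>degree p. monom (coeff p i) i)"
    unfolding q_def higher_pderiv_sum[of 1, simplified] by (intro sum.cong) (auto simp: pderiv_monom simp del: of_nat_Suc)
  also have "\<dots> = p" by (simp add: poly_as_sum_of_monoms)
  finally have "twisted_pderiv c q = p" using True by (simp add: twisted_pderiv_def)
  moreover have "degree q \<le> Suc (degree p)"
    unfolding q_def by (intro degree_sum_le order_trans[OF degree_monom_le]) auto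
  moreover have "p = 0 \<longrightarrow> q = 0" by (simp add: q_def)
  ultimately show ?thesis using True by (intro exI[of _ q]) auto
next
  case False
  have "\<exists>q. twisted_pderiv c q = p \<and> (q = 0 \<or> degree q \<le> degree p) \<and> (p = 0 \<longrightarrow> q = 0)"
  proof (induction "degree p" arbitrary: p rule: less_induct)
    case less
    show ?case
    proof (cases "degree p = 0")
      case True
      then obtain k where "p = [:k:]" using degree_eq_zeroE by blast
      then show ?thesis using False by (intro exI[of _ "[:k / c:]"]) (auto simp: twisted_pderiv_def pderiv_pCons)
    next
      case dp: False
      then have "degree (smult (1/c) (pderiv p)) < degree p" by (simp add: degree_pderiv)
      then obtain r where r: "twisted_pderiv c r = smult (1/c) (pderiv p)" "r = 0 \<or> degree r \<le> degree (smult (1/c) (pderiv p))"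
        using less by blast
      \<comment> \<open>Since (p / c)' + c (p / c) = p + p' / c, the excess p' / c has to be
        removed; \<open>r\<close> does so and exists by induction because p' has lower
        degree.\<close>
      have "twisted_pderiv c (smult (1/c) p - r) = p"
        using r(1) False by (simp add: twisted_pderiv_def pderiv_diff pderiv_smult smult_diff_right algebra_simps)
      moreover have "degree (smult (1/c) p - r) \<le> degree p"
        using r(2) dp by (intro degree_diff_le) (auto simp: degree_pderiv split: if_splits)
      moreover have "p \<noteq> 0" using dp by auto
      ultimately show ?thesis by blast
    qed
  qed
  then show ?thesis using False by (auto simp: less_Suc_eq_le)
qed

section \<open>Solution spaces of constant-coefficient equations\<close>

lemma pop_smult: "poly_diff_op (smult c h) u x = c * poly_diff_op h u x"
  by (simp add: pop_eq_bound[OF degree_smult_le] poly_diff_op_def[of h] sum_distrib_left mult_ac)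

text \<open>The factors of a constant-coefficient operator commute, so any of them can act on the
  function first. This peels off one linear factor at a time.\<close>

lemma pop_mult_linear:
  assumes U: "open U" "x \<in> U" and u: "u holomorphic_on U"
  shows "poly_diff_op ([:-c, 1:] * h) u x = poly_diff_op h (\<lambda>x. deriv u x - c * u x) x"
proof -
  have du: "(deriv ^^ k) (\<lambda>x. deriv u x - c * u x) x = (deriv ^^ Suc k) u x - c * (deriv ^^ k) u x" for k
  proof -
    have "(deriv ^^ k) (\<lambda>x. deriv u x - c * u x) x = (deriv ^^ k) (deriv u) x - (deriv ^^ k) (\<lambda>x. c * u x) x"
      using assms by (intro higher_deriv_diff[where S = U] holomorphic_intros) auto
    also have "(deriv ^^ k) (\<lambda>x. c * u x) x = c * (deriv ^^ k) u x"
      using assms by (intro higher_deriv_cmult[where A = U]) auto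
    finally show ?thesis by (simp add: funpow_swap1)
  qed
  have "[:-c, 1:] * h = pCons 0 h + smult (-c) h" by simp
  then have "poly_diff_op ([:-c, 1:] * h) u x = poly_diff_op (pCons 0 h) u x - c * poly_diff_op h u x"
    by (simp only: pop_add pop_smult) simp
  also have "poly_diff_op (pCons 0 h) u x = (\<Sum>k\<le>Suc (degree h). coeff (pCons 0 h) k * (deriv ^^ k) u x)"
    by (rule pop_eq_bound) (simp add: degree_pCons_le)
  also have "\<dots> = (\<Sum>k\<le>degree h. coeff h k * (deriv ^^ Suc k) u x)"
    by (subst sum.atMost_Suc_shift) simp
  finally show ?thesis
    by (simp only: poly_diff_op_def du right_diff_distrib sum_subtractf sum_distrib_left) (simp add: mult_ac)
qed

lemma prod_power_decr:
  assumes "finite I" "i0 \<in> I" "0 < M i0"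
  shows "(\<Prod>i\<in>I. (F i :: complex poly) ^ M i) = F i0 * (\<Prod>i\<in>I. F i ^ (M(i0 := M i0 - 1)) i)"
    and "(\<Sum>i\<in>I. (M(i0 := M i0 - 1)) i) < (\<Sum>i\<in>I. M i :: nat)"
proof -
  have "(\<Prod>i\<in>I - {i0}. F i ^ (M(i0 := M i0 - 1)) i) = (\<Prod>i\<in>I - {i0}. F i ^ M i)"
    by (rule prod.cong) auto
  then show "(\<Prod>i\<in>I. F i ^ M i) = F i0 * (\<Prod>i\<in>I. F i ^ (M(i0 := M i0 - 1)) i)"
    using assms by (simp add: prod.remove[of I i0] power_eq_if[of _ "M i0"])
  have "(\<Sum>i\<in>I - {i0}. (M(i0 := M i0 - 1)) i) = (\<Sum>i\<in>I - {i0}. M i)"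
    by (rule sum.cong) auto
  then show "(\<Sum>i\<in>I. (M(i0 := M i0 - 1)) i) < (\<Sum>i\<in>I. M i)"
    using assms by (simp add: sum.remove[of I i0])
qed

text \<open>On the component of frequency \<mu> i the operator D - c lowers degrees exactly when c =
  \<mu> i, for then the twist disappears.\<close>

lemma deriv_qp_minus:
  "deriv (quasi_poly I \<mu> p) x - c * quasi_poly I \<mu> p x = quasi_poly I \<mu> (\<lambda>i. twisted_pderiv (\<mu> i - c) (p i)) x"
  by (simp add: deriv_qp qp_smult qp_diff twisted_pderiv_def algebra_simps smult_diff_left)

text \<open>Induction on the total multiplicity. By induction v = (D - \<mu> i0) u is a
  quasi-polynomial; lifting it through \<open>ex_tw_eq\<close> leaves a solution of w' = \<mu> i0 w,
  which uniqueness makes a multiple of the exponential. No primitive is taken on \<open>U\<close>,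
  so monodromy cannot interfere.\<close>

lemma pop_eq_0_imp_qp:
  assumes I: "finite I" "inj_on \<mu> I" and U: "open U" "connected U" "U \<noteq> {}"
    and "u holomorphic_on U" "\<And>x. x \<in> U \<Longrightarrow> poly_diff_op (\<Prod>i\<in>I. [:- \<mu> i, 1:] ^ M i) u x = 0"
  shows "\<exists>p. (\<forall>i\<in>I. p i = 0 \<or> degree (p i) < M i) \<and> (\<forall>x\<in>U. u x = quasi_poly I \<mu> p x)"
  using assms(6,7)
proof (induction "\<Sum>i\<in>I. M i" arbitrary: M u rule: less_induct)
  case less
  show ?case
  proof (cases "\<exists>i0\<in>I. 0 < M i0")
    case False
    then have "(\<Prod>i\<in>I. [:- \<mu> i, 1:] ^ M i) = 1" by (intro prod.neutral) auto
    then have "u x = 0" if "x \<in> U" for x using less.prems(2)[OF that] by (simp add: poly_diff_op_def)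
    then show ?thesis by (intro exI[of _ "\<lambda>i. 0"]) auto
  next
    case True
    then obtain i0 where i0: "i0 \<in> I" "0 < M i0" by blast
    define M' where "M' = M(i0 := M i0 - 1)"
    define v where "v x = deriv u x - \<mu> i0 * u x" for x
    have v: "v holomorphic_on U" unfolding v_def[abs_def] using less.prems U by (intro holomorphic_intros)
    have "poly_diff_op (\<Prod>i\<in>I. [:- \<mu> i, 1:] ^ M' i) v x = 0" if "x \<in> U" for x
      using less.prems(2)[OF that] pop_mult_linear[OF U(1) that less.prems(1)]
        prod_power_decr(1)[of I i0 M "\<lambda>i. [:- \<mu> i, 1:]"] i0 I
      by (simp only: M'_def v_def[abs_def])
    then obtain p where p: "\<forall>i\<in>I. p i = 0 \<or> degree (p i) < M' i" "\<forall>x\<in>U. v x = quasi_poly I \<mu> p x"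
      using less.hyps[OF _ v, of M'] prod_power_decr(2)[of I i0 M] i0 I unfolding M'_def by blast
    have "\<exists>q. \<forall>i. twisted_pderiv (\<mu> i - \<mu> i0) (q i) = p i
        \<and> (q i = 0 \<or> degree (q i) < Suc (degree (p i)) + (if \<mu> i - \<mu> i0 = 0 then 1 else 0)) \<and> (p i = 0 \<longrightarrow> q i = 0)"
      using ex_tw_eq by (intro choice allI)
    then obtain q where q: "\<And>i. twisted_pderiv (\<mu> i - \<mu> i0) (q i) = p i"
      "\<And>i. q i = 0 \<or> degree (q i) < Suc (degree (p i)) + (if \<mu> i - \<mu> i0 = 0 then 1 else 0)" "\<And>i. p i = 0 \<Longrightarrow> q i = 0"
      by blast
    obtain x0 where x0: "x0 \<in> U" using U by auto
    \<comment> \<open>Chosen so that \<open>w x0 = 0\<close>; first-order uniqueness then gives w =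
      0 on \<open>U\<close>.\<close>
    define C where "C = (u x0 - quasi_poly I \<mu> q x0) * exp (- \<mu> i0 * x0)"
    define w where "w x = u x - quasi_poly I \<mu> q x - C * exp (\<mu> i0 * x)" for x
    have w: "w holomorphic_on U" unfolding w_def[abs_def] using less.prems U by (intro holomorphic_intros)
    have "w x = 0" if x: "x \<in> U" for x
    proof (rule dop_jet_unique[OF U(1,2) _ w _ x0 _ x])
      show "\<forall>i<1. (\<lambda>i x. - \<mu> i0) i holomorphic_on U" by (auto intro: holomorphic_intros)
      fix y assume y: "y \<in> U"
      have "(u has_field_derivative deriv u y) (at y)"
        using less.prems(1) U(1) y holomorphic_derivI by blast
      moreover have "(quasi_poly I \<mu> q has_field_derivative deriv (quasi_poly I \<mu> q) y) (at y)"
        using qp_holomorphic[of I \<mu> q UNIV] holomorphic_derivI by blast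
      ultimately have "deriv w y = deriv u y - deriv (quasi_poly I \<mu> q) y - C * (\<mu> i0 * exp (\<mu> i0 * y))"
        unfolding w_def[abs_def] by (intro DERIV_imp_deriv) (auto intro!: derivative_eq_intros)
      then have "dop (\<lambda>i x. - \<mu> i0) 1 w y = v y - (deriv (quasi_poly I \<mu> q) y - \<mu> i0 * quasi_poly I \<mu> q y)"
        by (simp add: dop_def w_def v_def algebra_simps)
      then show "dop (\<lambda>i x. - \<mu> i0) 1 w y = 0"
        using p(2) y by (simp add: deriv_qp_minus q(1))
    next
      fix i :: nat assume "i < 1"
      moreover have "exp (- \<mu> i0 * x0) * exp (\<mu> i0 * x0) = 1" by (simp add: mult_exp_exp)
      then have "w x0 = 0" by (simp only: w_def C_def mult.assoc) simp
      ultimately show "(deriv ^^ i) w x0 = 0" by simp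
    qed
    note w0 = this
    have ux: "u x = quasi_poly I \<mu> q x + C * exp (\<mu> i0 * x)" if "x \<in> U" for x
      using w0[OF that] by (simp add: w_def diff_eq_eq add.commute)
    define q' where "q' = q(i0 := q i0 + [:C:])"
    have "quasi_poly I \<mu> q' x = quasi_poly I \<mu> q x + C * exp (\<mu> i0 * x)" for x
    proof -
      have "(\<Sum>i\<in>I - {i0}. poly (q' i) x * exp (\<mu> i * x)) = (\<Sum>i\<in>I - {i0}. poly (q i) x * exp (\<mu> i * x))"
        by (intro sum.cong) (auto simp: q'_def)
      then show ?thesis using I i0 by (simp add: quasi_poly_def sum.remove[of I i0] q'_def algebra_simps)
    qed
    moreover have "q' i = 0 \<or> degree (q' i) < M i" if i: "i \<in> I" for i
    proof (cases "i = i0")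
      case True
      have "degree (q i0) < M i0"
        using p(1) q(2)[of i0] q(3)[of i0] i0 by (auto simp: M'_def)
      then have "degree (q i0 + [:C:]) < M i0"
        using i0 degree_add_le_max[of "q i0" "[:C:]"] by simp
      then show ?thesis using True by (simp add: q'_def)
    next
      case False
      then have "\<mu> i \<noteq> \<mu> i0" using I i i0 by (auto simp: inj_on_def)
      then show ?thesis using False p(1) q(2)[of i] q(3)[of i] i by (auto simp: q'_def M'_def)
    qed
    ultimately show ?thesis using ux by (intro exI[of _ q']) auto
  qed
qed

text \<open>Each factor D - \<mu> i0 lowers the degree bound of component i0 by one and does not
  raise the others, until nothing is left.\<close>

lemma pop_qp_eq_0:
  assumes I: "finite I" and "\<And>i. i \<in> I \<Longrightarrow> p i = 0 \<or> degree (p i) < M i"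
  shows "poly_diff_op (\<Prod>i\<in>I. [:- \<mu> i, 1:] ^ M i) (quasi_poly I \<mu> p) x = 0"
  using assms(2)
proof (induction "\<Sum>i\<in>I. M i" arbitrary: M p x rule: less_induct)
  case less
  show ?case
  proof (cases "\<exists>i0\<in>I. 0 < M i0")
    case False
    then have "(\<Prod>i\<in>I. [:- \<mu> i, 1:] ^ M i) = 1" by (intro prod.neutral) auto
    moreover have "quasi_poly I \<mu> p = quasi_poly I \<mu> (\<lambda>i. 0)"
      using False less.prems by (intro qp_cong) auto
    ultimately show ?thesis by (simp add: poly_diff_op_def)
  next
    case True
    then obtain i0 where i0: "i0 \<in> I" "0 < M i0" by blast
    define M' where "M' = M(i0 := M i0 - 1)"
    define p' where "p' i = twisted_pderiv (\<mu> i - \<mu> i0) (p i)" for i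
    have "p' i = 0 \<or> degree (p' i) < M' i" if "i \<in> I" for i
    proof (cases "i = i0")
      case True
      then show ?thesis using less.prems[OF that] i0
        by (auto simp: p'_def M'_def twisted_pderiv_def degree_pderiv pderiv_eq_0_iff)
    next
      case False
      have "degree (p' i) \<le> degree (p i)" unfolding p'_def twisted_pderiv_def
        by (intro degree_add_le) (auto simp: degree_pderiv)
      then show ?thesis using less.prems[OF that] False by (auto simp: p'_def M'_def twisted_pderiv_def)
    qed
    then have 0: "poly_diff_op (\<Prod>i\<in>I. [:- \<mu> i, 1:] ^ M' i) (quasi_poly I \<mu> p') x = 0"
      using less.hyps[of M' p' x] prod_power_decr(2)[of I i0 M, OF I i0] by (simp only: M'_def)
    have "poly_diff_op (\<Prod>i\<in>I. [:- \<mu> i, 1:] ^ M i) (quasi_poly I \<mu> p) x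
        = poly_diff_op ([:- \<mu> i0, 1:] * (\<Prod>i\<in>I. [:- \<mu> i, 1:] ^ M' i)) (quasi_poly I \<mu> p) x"
      unfolding M'_def prod_power_decr(1)[of I i0 M, OF I i0] ..
    also have "\<dots> = poly_diff_op (\<Prod>i\<in>I. [:- \<mu> i, 1:] ^ M' i) (\<lambda>x. deriv (quasi_poly I \<mu> p) x - \<mu> i0 * quasi_poly I \<mu> p x) x"
      by (rule pop_mult_linear[OF open_UNIV UNIV_I qp_holomorphic])
    also have "(\<lambda>x. deriv (quasi_poly I \<mu> p) x - \<mu> i0 * quasi_poly I \<mu> p x) = quasi_poly I \<mu> p'"
      by (simp add: deriv_qp_minus p'_def[abs_def])
    finally show ?thesis using 0 by simp
  qed
qed

subsection \<open>The dimension of the kernel\<close>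

text \<open>Scalar multiplication for a vector space of functions. The argument type stays free
  since both functions of x and vectors of leading coefficients (functions of an index) are treated
  as vectors.\<close>

definition fun_scale :: "complex \<Rightarrow> ('a \<Rightarrow> complex) \<Rightarrow> 'a \<Rightarrow> complex" where
  "fun_scale c f = (\<lambda>x. c * f x)"

global_interpretation fvs: vector_space "fun_scale :: complex \<Rightarrow> ('a \<Rightarrow> complex) \<Rightarrow> 'a \<Rightarrow> complex"
  by unfold_locales (auto simp: fun_scale_def algebra_simps fun_eq_iff)

lemma sum_scl_apply: "(\<Sum>k\<in>A. fun_scale (w k) (f k)) x = (\<Sum>k\<in>A. w k * f k x)"
  by (induction A rule: infinite_finite_induct) (auto simp: fun_scale_def)

lemma fvs_indep_iff:
  assumes "finite B"
  shows "fvs.independent B \<longleftrightarrow> (\<forall>w. (\<forall>x. (\<Sum>b\<in>B. w b * b x) = 0) \<longrightarrow> (\<forall>b\<in>B. w b = 0))"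
  unfolding fvs.dependent_finite[OF assms] by (auto simp: fun_eq_iff sum_scl_apply)

lemma lin_indep_iff: "lin_indep B \<longleftrightarrow> finite B \<and> fvs.independent B"
  using fvs_indep_iff[of B] by (auto simp: lin_indep_def fun_eq_iff)

lemma fvs_span_iff:
  assumes "finite B"
  shows "f \<in> fvs.span B \<longleftrightarrow> (\<exists>w. \<forall>x. f x = (\<Sum>b\<in>B. w b * b x))"
  unfolding fvs.span_finite[OF assms] by (auto simp: fun_eq_iff sum_scl_apply image_def)

text \<open>Injectivity is part of the claim because bases are sets: a repeated member would
  silently disappear from the image.\<close>

lemma fvs_indep_family:
  assumes C: "finite C" and ind: "\<And>w. (\<And>x. (\<Sum>c\<in>C. w c * f c x) = 0) \<Longrightarrow> \<forall>c\<in>C. w c = 0"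
  shows "inj_on f C" "fvs.independent (f ` C)"
proof -
  show inj: "inj_on f C"
  proof (rule inj_onI, rule ccontr)
    fix c c' assume c: "c \<in> C" "c' \<in> C" "f c = f c'" "c \<noteq> c'"
    \<comment> \<open>Two equal members would give the relation f c - f c' = 0.\<close>
    define w :: "'a \<Rightarrow> complex" where "w k = (if k = c then 1 else 0) - (if k = c' then 1 else 0)" for k
    have "(\<Sum>k\<in>C. w k * f k x) = 0" for x
    proof -
      have "(\<Sum>k\<in>C. w k * f k x) = (\<Sum>k\<in>C. if k = c then f k x else 0) - (\<Sum>k\<in>C. if k = c' then f k x else 0)"
        unfolding sum_subtractf[symmetric] by (intro sum.cong) (auto simp: w_def)
      then show ?thesis using c C by (simp add: sum.delta)
    qed
    then show False using ind[of w] c by (auto simp: w_def)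
  qed
  show "fvs.independent (f ` C)"
    unfolding fvs_indep_iff[OF finite_imageI[OF C]] sum.reindex[OF inj] o_def
  proof (intro allI impI)
    fix w assume "\<forall>x. (\<Sum>c\<in>C. w (f c) * f c x) = 0"
    then have "\<forall>c\<in>C. w (f c) = 0" using ind[of "\<lambda>c. w (f c)"] by blast
    then show "\<forall>b\<in>f ` C. w b = 0" by auto
  qed
qed

text \<open>Applied with \<open>v c\<close> a list of \<open>e\<close> derivatives at one point:
  functions with independent jets of length \<open>e\<close> are at most \<open>e\<close> in
  number.\<close>

lemma card_le_if_no_relation:
  fixes v :: "'c \<Rightarrow> nat \<Rightarrow> complex"
  assumes C: "finite C" and ind: "\<And>w. (\<And>i. i < e \<Longrightarrow> (\<Sum>c\<in>C. w c * v c i) = 0) \<Longrightarrow> \<forall>c\<in>C. w c = 0"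
  shows "card C \<le> e"
proof -
  define f where "f c i = (if i < e then v c i else 0)" for c i
  have ind': "\<forall>c\<in>C. w c = 0" if w: "\<And>x. (\<Sum>c\<in>C. w c * f c x) = 0" for w
  proof -
    have "(\<Sum>c\<in>C. w c * v c i) = 0" if "i < e" for i using w[of i] that by (simp add: f_def)
    then show ?thesis by (rule ind)
  qed
  note * = fvs_indep_family[of C f, OF C ind']
  define E :: "nat \<Rightarrow> nat \<Rightarrow> complex" where "E i = (\<lambda>j. if j = i then 1 else 0)" for i
  have "f c \<in> fvs.span (E ` {..<e})" for c
  proof -
    have "f c = (\<Sum>i<e. fun_scale (v c i) (E i))"
      by (rule ext) (simp add: sum_scl_apply f_def E_def if_distrib sum.delta cong: if_cong)
    also have "\<dots> \<in> fvs.span (E ` {..<e})"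
      by (intro fvs.span_sum fvs.span_scale fvs.span_base) auto
    finally show ?thesis .
  qed
  then have "card (f ` C) \<le> card (E ` {..<e})"
    using fvs.independent_span_bound[OF _ *(2), of "E ` {..<e}"] by auto
  also have "\<dots> \<le> e" using card_image_le[of "{..<e}" E] by simp
  finally show ?thesis using card_image[OF *(1)] by simp
qed

lemma poly_bounded_sum:
  assumes "p = 0 \<or> degree p < m"
  shows "poly p (x::complex) = (\<Sum>k<m. coeff p k * x ^ k)"
proof (cases "p = 0")
  case False
  then have "degree p < m" using assms by simp
  then show ?thesis unfolding poly_altdef
    by (intro sum.mono_neutral_left) (auto simp: coeff_eq_0)
qed simp

lemma darboux_kernel_qp:
  assumes U: "open U" "connected U" "U \<noteq> {}" and D: "darboux_data U f g a d b e"
    and I: "finite I" "inj_on \<mu> I" and fg: "f * g = (\<Prod>i\<in>I. [:- \<mu> i, 1:] ^ M i)"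
    and u: "u holomorphic_on U" "\<And>x. x \<in> U \<Longrightarrow> dop a d u x = 0"
  shows "\<exists>p. (\<forall>i\<in>I. p i = 0 \<or> degree (p i) < M i) \<and> (\<forall>x\<in>U. u x = quasi_poly I \<mu> p x)"
proof (rule pop_eq_0_imp_qp[OF I U u(1)])
  fix x assume x: "x \<in> U"
  have "dop b e (dop a d u) x = dop b e (\<lambda>_. 0) x"
    using u D U(1) by (intro dop_cong[OF U(1) x] dop_holomorphic) (auto simp: darboux_data_def)
  also have "\<dots> = 0" using dop_cmult[OF U(1) x, of "\<lambda>_. 0" b e 0] by simp
  finally show "poly_diff_op (\<Prod>i\<in>I. [:- \<mu> i, 1:] ^ M i) u x = 0" using darboux_comp[OF U(1) D x u(1)] fg by simp
qed

text \<open>The order of P is the dimension of its kernel, by counting dimensions in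
  ker P \<rightarrow> ker (Q P) \<rightarrow> ker Q; this replaces the existence theorem for linear equations.\<close>
lemma darboux_kernel_card:
  assumes U: "open U" "connected U" "U \<noteq> {}" and D: "darboux_data U f g a d b e"
    and I: "finite I" "inj_on \<mu> I" and fg: "f * g = (\<Prod>i\<in>I. [:- \<mu> i, 1:] ^ M i)"
    and B: "finite B" "fvs.independent B" "\<And>u. u \<in> B \<Longrightarrow> u holomorphic_on UNIV"
      "\<And>u x. u \<in> B \<Longrightarrow> x \<in> U \<Longrightarrow> dop a d u x = 0"
    and ker: "\<And>u. u holomorphic_on U \<Longrightarrow> (\<And>x. x \<in> U \<Longrightarrow> dop a d u x = 0) \<Longrightarrow>
      \<exists>w. \<forall>x\<in>U. u x = (\<Sum>v\<in>B. w v * v x)"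
  shows "card B = d"
proof (rule antisym)
  have a: "\<forall>i<d. a i holomorphic_on U" and b: "\<forall>i<e. b i holomorphic_on U"
    using D by (auto simp: darboux_data_def)
  obtain x0 where x0: "x0 \<in> U" using U by auto
  have holB: "u holomorphic_on S" if "u \<in> B" for u S
    using B(3)[OF that] holomorphic_on_subset by blast
  \<comment> \<open>By uniqueness, an element of ker P is determined by its derivatives of orders
    below d at \<open>x0\<close>.\<close>
  show "card B \<le> d"
  proof (rule card_le_if_no_relation[OF B(1), where v = "\<lambda>u i. (deriv ^^ i) u x0"])
    fix w assume w: "\<And>i. i < d \<Longrightarrow> (\<Sum>u\<in>B. w u * (deriv ^^ i) u x0) = 0"
    define W where "W x = (\<Sum>u\<in>B. w u * u x)" for x
    have "W x = 0" if "x \<in> U" for x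
    proof (rule dop_jet_unique[OF U(1,2) a _ _ x0 _ that])
      show "W holomorphic_on U" unfolding W_def using holB by (intro holomorphic_intros)
      show "dop a d W x = 0" if "x \<in> U" for x
        using dop_lin_comb[OF U(1) that, of B "\<lambda>u. u" a d w] B(4) holB that
        by (simp add: W_def[abs_def])
      show "(deriv ^^ i) W x0 = 0" if "i < d" for i
        using higher_deriv_lin_comb[OF U(1) x0, of B "\<lambda>u. u" i w] holB w that
        by (simp add: W_def[abs_def])
    qed
    moreover have "W holomorphic_on UNIV" unfolding W_def using holB by (intro holomorphic_intros)
    ultimately have "W x = 0" for x using entire_eq_0[OF _ U(1,3)] by blast
    then show "\<forall>u\<in>B. w u = 0" using B(2) fvs_indep_iff[OF B(1)] by (simp add: W_def)
  qed
  \<comment> \<open>\<open>J\<close> indexes the standard basis x^k exp (\<mu> i x), k < M i, of the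
    kernel of Q P = h(D); it has d + e members.\<close>
  define J where "J = Sigma I (\<lambda>i. {..<M i})"
  define \<phi> where "\<phi> = (\<lambda>j x. x ^ snd j * exp (\<mu> (fst j) * x))"
  have J: "finite J" using I by (simp add: J_def)
  have qpJ: "(\<Sum>j\<in>J. w j * \<phi> j x) = quasi_poly I \<mu> (\<lambda>i. \<Sum>k<M i. monom (w (i, k)) k) x" for w x
    using I by (simp add: J_def \<phi>_def quasi_poly_def sum.Sigma case_prod_beta poly_sum poly_monom sum_distrib_right mult.assoc)
  have deg: "(\<Sum>k<m. monom (c k) k) = 0 \<or> degree (\<Sum>k<m. monom (c k) k) < m" for m and c :: "nat \<Rightarrow> complex"
    by (cases "m = 0") (auto intro!: degree_sum_less order.strict_trans1[OF degree_monom_le])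
  have indJ': "\<forall>c\<in>J. w c = 0" if w: "\<And>x. (\<Sum>c\<in>J. w c * \<phi> c x) = 0" for w
  proof -
    from w have 0: "(\<Sum>k<M i. monom (w (i, k)) k) = 0" if "i \<in> I" for i
      using qp_eq_0_imp[OF I U(1,3) _ that, of "\<lambda>i. \<Sum>k<M i. monom (w (i, k)) k"] unfolding qpJ by auto
    have "w (i, k) = 0" if "i \<in> I" "k < M i" for i k
      using arg_cong[OF 0[OF that(1)], of "\<lambda>p. coeff p k"] that by (simp add: coeff_sum)
    then show ?thesis by (auto simp: J_def)
  qed
  note indJ = fvs_indep_family[of J \<phi>, OF J indJ']
  have cardJ: "card (\<phi> ` J) = d + e"
  proof -
    have "degree (f * g) = (\<Sum>i\<in>I. degree ([:- \<mu> i, 1:] ^ M i))"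
      unfolding fg using I by (subst degree_prod_eq_sum_degree) auto
    also have "\<dots> = card J" using I by (simp add: J_def degree_power_eq)
    finally show ?thesis using darboux_degree[OF U(1,3) D] card_image[OF indJ(1)] by simp
  qed
  have span: "u \<in> fvs.span (\<phi> ` J) \<longleftrightarrow> (\<exists>p. (\<forall>i\<in>I. p i = 0 \<or> degree (p i) < M i) \<and> u = quasi_poly I \<mu> p)" for u
  proof
    assume "u \<in> fvs.span (\<phi> ` J)"
    then obtain w where "\<And>x. u x = (\<Sum>v\<in>\<phi> ` J. w v * v x)" using fvs_span_iff[of "\<phi> ` J" u] J by auto
    then have "u x = (\<Sum>j\<in>J. w (\<phi> j) * \<phi> j x)" for x by (simp add: sum.reindex[OF indJ(1)])
    then have "u = quasi_poly I \<mu> (\<lambda>i. \<Sum>k<M i. monom (w (\<phi> (i, k))) k)" unfolding qpJ[of "\<lambda>j. w (\<phi> j)"] by auto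
    then show "\<exists>p. (\<forall>i\<in>I. p i = 0 \<or> degree (p i) < M i) \<and> u = quasi_poly I \<mu> p"
      using deg by (intro exI[of _ "\<lambda>i. \<Sum>k<M i. monom (w (\<phi> (i, k))) k"]) simp
  next
    assume "\<exists>p. (\<forall>i\<in>I. p i = 0 \<or> degree (p i) < M i) \<and> u = quasi_poly I \<mu> p"
    then obtain p where p: "\<And>i. i \<in> I \<Longrightarrow> p i = 0 \<or> degree (p i) < M i" "u = quasi_poly I \<mu> p" by blast
    have eq: "u = (\<Sum>j\<in>J. fun_scale (coeff (p (fst j)) (snd j)) (\<phi> j))"
    proof
      fix x show "u x = (\<Sum>j\<in>J. fun_scale (coeff (p (fst j)) (snd j)) (\<phi> j)) x"
        unfolding sum_scl_apply qpJ p(2) quasi_poly_def using p(1)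
        by (intro sum.cong) (auto simp: poly_sum poly_monom poly_bounded_sum)
    qed
    show "u \<in> fvs.span (\<phi> ` J)"
      unfolding eq by (rule fvs.span_sum, rule fvs.span_scale, rule fvs.span_base, rule imageI)
  qed
  have "B \<subseteq> fvs.span (\<phi> ` J)"
  proof
    fix u assume u: "u \<in> B"
    obtain p where p: "\<forall>i\<in>I. p i = 0 \<or> degree (p i) < M i" "\<forall>x\<in>U. u x = quasi_poly I \<mu> p x"
      using darboux_kernel_qp[OF U D I fg holB[OF u] B(4)[OF u]] by blast
    have "u x - quasi_poly I \<mu> p x = 0" for x
    proof (rule entire_eq_0[OF _ U(1,3), where f = "\<lambda>x. u x - quasi_poly I \<mu> p x"])
      show "(\<lambda>x. u x - quasi_poly I \<mu> p x) holomorphic_on UNIV"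
        by (rule holomorphic_on_diff[OF holB[OF u] qp_holomorphic])
    qed (simp add: p(2))
    then show "u \<in> fvs.span (\<phi> ` J)" unfolding span using p(1) by (intro exI[of _ p] conjI ext) auto
  qed
  \<comment> \<open>Extends \<open>B\<close> to a basis of the whole kernel of Q P; \<open>C\<close>
    below is the added part.\<close>
  then obtain B' where B': "B \<subseteq> B'" "B' \<subseteq> fvs.span (\<phi> ` J)" "fvs.independent B'" "fvs.span (\<phi> ` J) \<subseteq> fvs.span B'"
    using fvs.maximal_independent_subset_extend[OF _ B(2)] by metis
  have finB': "finite B'" using fvs.independent_span_bound[OF _ B'(3,2)] J by auto
  have "\<phi> ` J \<subseteq> fvs.span B'" using B'(4) fvs.span_base by blast
  then have le: "d + e \<le> card B'"
    using fvs.independent_span_bound[OF finB' indJ(2)] cardJ by simp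
  define C where "C = B' - B"
  have C: "finite C" using finB' by (simp add: C_def)
  have hol: "u holomorphic_on S" if "u \<in> B'" for u S
  proof -
    have "u \<in> fvs.span (\<phi> ` J)" using that B'(2) by blast
    then obtain p where "u = quasi_poly I \<mu> p" unfolding span by blast
    then show ?thesis by (simp add: qp_holomorphic)
  qed
  \<comment> \<open>P maps the span of \<open>C\<close> into ker Q, and injectively, since a
    combination killed by P lies in the span of \<open>B\<close>. Jets of length e at
    \<open>x0\<close> therefore bound \<open>card C\<close>.\<close>
  have "card C \<le> e"
  proof (rule card_le_if_no_relation[OF C, where v = "\<lambda>u i. (deriv ^^ i) (dop a d u) x0"])
    fix w assume w: "\<And>i. i < e \<Longrightarrow> (\<Sum>u\<in>C. w u * (deriv ^^ i) (dop a d u) x0) = 0"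
    define W where "W x = (\<Sum>u\<in>C. w u * u x)" for x
    have holW: "W holomorphic_on S" for S unfolding W_def using hol by (auto intro!: holomorphic_intros simp: C_def)
    have PW: "dop a d W x = (\<Sum>u\<in>C. w u * dop a d u x)" if "x \<in> U" for x
      using dop_lin_comb[OF U(1) that, of C "\<lambda>u. u" a d w] hol by (simp add: W_def[abs_def] C_def)
    have hPW: "dop a d u holomorphic_on U" if "u \<in> C" for u
      using that hol by (intro dop_holomorphic[OF U(1) _ a]) (auto simp: C_def)
    have "dop a d W x = 0" if "x \<in> U" for x
    proof (rule dop_jet_unique[OF U(1,2) b _ _ x0 _ that])
      show "dop a d W holomorphic_on U" by (rule dop_holomorphic[OF U(1) holW a])
      show "dop b e (dop a d W) x = 0" if "x \<in> U" for x
      proof -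
        have "W \<in> fvs.span (\<phi> ` J)"
        proof -
          have "W = (\<Sum>u\<in>C. fun_scale (w u) u)" by (auto simp: W_def sum_scl_apply)
          then show ?thesis using B'(2) by (auto intro!: fvs.span_sum fvs.span_scale simp: C_def)
        qed
        then obtain p where "\<And>i. i \<in> I \<Longrightarrow> p i = 0 \<or> degree (p i) < M i" "W = quasi_poly I \<mu> p" unfolding span by blast
        then show ?thesis using darboux_comp[OF U(1) D that holW] fg pop_qp_eq_0[OF I(1)] by simp
      qed
      show "(deriv ^^ i) (dop a d W) x0 = 0" if "i < e" for i
      proof -
        have "(deriv ^^ i) (dop a d W) x0 = (deriv ^^ i) (\<lambda>x. \<Sum>u\<in>C. w u * dop a d u x) x0"
          using PW U x0 hPW by (intro higher_deriv_transform_within_open[where S = U] dop_holomorphic[OF U(1) holW a])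
             (auto intro!: holomorphic_intros)
        also have "\<dots> = (\<Sum>u\<in>C. w u * (deriv ^^ i) (dop a d u) x0)"
          using hPW by (intro higher_deriv_lin_comb[OF U(1) x0])
        finally show ?thesis using w[OF that] by simp
      qed
    qed
    then obtain w' where w': "\<forall>x\<in>U. W x = (\<Sum>v\<in>B. w' v * v x)" using ker[OF holW] by blast
    have "W x - (\<Sum>v\<in>B. w' v * v x) = 0" for x
    proof (rule entire_eq_0[OF _ U(1,3), where f = "\<lambda>x. W x - (\<Sum>v\<in>B. w' v * v x)"])
      show "(\<lambda>x. W x - (\<Sum>v\<in>B. w' v * v x)) holomorphic_on UNIV"
        by (rule holomorphic_on_diff[OF holW], rule holomorphic_on_sum, rule holomorphic_on_mult)
          (auto intro: holB)
    qed (use w' in simp)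
    \<comment> \<open>One relation on \<open>B'\<close>, with opposite signs on \<open>C\<close> and
      \<open>B\<close>, so that independence of \<open>B'\<close> kills all weights on
      \<open>C\<close>.\<close>
    moreover have "W x - (\<Sum>v\<in>B. w' v * v x) = (\<Sum>v\<in>B'. (if v \<in> C then w v else - w' v) * v x)" for x
    proof -
      have "B' = C \<union> B" "C \<inter> B = {}" using B'(1) by (auto simp: C_def)
      moreover have "(\<Sum>v\<in>B. (if v \<in> C then w v else - w' v) * v x) = - (\<Sum>v\<in>B. w' v * v x)"
        unfolding sum_negf[symmetric] by (intro sum.cong) (auto simp: C_def)
      ultimately show ?thesis using C B(1) by (simp add: sum.union_disjoint W_def)
    qed
    ultimately have "\<forall>v\<in>B'. (if v \<in> C then w v else - w' v) = 0"
      using B'(3) unfolding fvs_indep_iff[OF finB'] by (elim allE[where x = "\<lambda>v. if v \<in> C then w v else - w' v"]) simp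
    then show "\<forall>u\<in>C. w u = 0" by (auto simp: C_def)
  qed
  moreover have "card B' = card C + card B"
    using finB' B'(1) by (simp add: C_def card_Diff_subset B(1) card_mono)
  ultimately show "d \<le> card B" using le by simp
qed

text \<open>Cramer's rule: \<open>N\<close> is the adjugate of \<open>M\<close> and \<open>q\<close>
  the determinant, an inverse up to a factor that keeps the entries polynomial. Independence at the
  single value \<open>t0\<close> makes \<open>q\<close> nonzero there.\<close>

lemma adjugate_poly:
  fixes M :: "nat \<Rightarrow> nat \<Rightarrow> complex poly"
  assumes ind: "\<And>w. (\<And>i. i < d \<Longrightarrow> (\<Sum>k<d. w k * poly (M k i) t0) = 0) \<Longrightarrow> \<forall>k<d. w k = 0"
  obtains q N where "poly q t0 \<noteq> 0"
    "\<And>j j'. j < d \<Longrightarrow> j' < d \<Longrightarrow> (\<Sum>k<d. N j k * M k j') = (if j = j' then q else 0)"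
proof
  define A where "A = mat d d (\<lambda>(k, i). M k i)"
  have A: "A \<in> carrier_mat d d" by (simp add: A_def)
  \<comment> \<open>Transposed, so that a kernel vector is a relation \<open>w\<close> between the
    rows of \<open>M\<close>; the determinant is unaffected.\<close>
  define A0 where "A0 = mat d d (\<lambda>(i, k). poly (M k i) t0)"
  have A0: "A0 \<in> carrier_mat d d" by (simp add: A0_def)
  have "det A0 \<noteq> 0"
  proof
    assume "det A0 = 0"
    then obtain v where v: "v \<in> carrier_vec d" "v \<noteq> 0\<^sub>v d" "A0 *\<^sub>v v = 0\<^sub>v d"
      using det_0_iff_vec_prod_zero_field[OF A0] by blast
    have "\<forall>k<d. vec_index v k = 0"
    proof (rule ind)
      fix i assume i: "i < d"
      have "vec_index (A0 *\<^sub>v v) i = (\<Sum>k<d. poly (M k i) t0 * vec_index v k)"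
        using i v(1) by (simp add: A0_def scalar_prod_def atLeast0LessThan)
      then show "(\<Sum>k<d. vec_index v k * poly (M k i) t0) = 0" using v(3) i by (simp add: mult.commute)
    qed
    then show False using v(1,2) by auto
  qed
  moreover have "det A0 = poly (det (transpose_mat A)) t0"
  proof -
    have "index_mat A0 (i, x i) = poly (index_mat (transpose_mat A) (i, x i)) t0"
      if "x permutes {0..<d}" "i < d" for x i
      using permutes_in_image[OF that(1), of i] that(2) by (simp add: A0_def A_def)
    note * = this
    have A': "transpose_mat A \<in> carrier_mat d d" using A by simp
    have s: "signof x = poly (signof x) t0" for x :: "nat \<Rightarrow> nat"
      by (simp add: of_int_poly)
    show ?thesis
      unfolding det_def'[OF A0] det_def'[OF A'] poly_sum poly_mult poly_prod
    proof (rule sum.cong[OF refl])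
      fix x assume "x \<in> {x. x permutes {0..<d}}"
      then have "(\<Prod>i = 0..<d. index_mat A0 (i, x i)) = (\<Prod>i = 0..<d. poly (index_mat (transpose_mat A) (i, x i)) t0)"
        by (intro prod.cong refl *) auto
      then show "signof x * (\<Prod>i = 0..<d. index_mat A0 (i, x i))
          = poly (signof x) t0 * (\<Prod>i = 0..<d. poly (index_mat (transpose_mat A) (i, x i)) t0)"
        by (simp only: s[symmetric])
    qed
  qed
  ultimately show "poly (det A) t0 \<noteq> 0" by (metis det_transpose[OF A])
  fix j j' assume j: "j < d" "j' < d"
  have "index_mat (adj_mat A * A) (j, j') = (\<Sum>k<d. index_mat (adj_mat A) (j, k) * M k j')"
    using j adj_mat(1)[OF A] by (simp add: A_def scalar_prod_def atLeast0LessThan)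
  then show "(\<Sum>k<d. index_mat (adj_mat A) (j, k) * M k j') = (if j = j' then det A else 0)"
    using adj_mat(3)[OF A] j by (cases "j = j'") simp_all
qed

subsection \<open>Kernels closed under differentiation of the coefficients\<close>

lemma tw_0 [simp]: "twisted_pderiv c 0 = 0"
  by (simp add: twisted_pderiv_def)

lemma tw_pow_0 [simp]: "(twisted_pderiv c ^^ i) 0 = 0"
  by (induction i) auto

lemma tw_pcompose: "(twisted_pderiv c ^^ i) (p \<circ>\<^sub>p [:s, 1:]) = (twisted_pderiv c ^^ i) p \<circ>\<^sub>p [:s, 1:]"
  by (induction i) (auto simp: twisted_pderiv_def pderiv_pcompose pcompose_add pcompose_smult pderiv_pCons)

lemma pderiv_tw: "pderiv ((twisted_pderiv c ^^ i) p) = (twisted_pderiv c ^^ i) (pderiv p)"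
  by (induction i) (auto simp: twisted_pderiv_def pderiv_add pderiv_smult)

text \<open>P at a fixed x, applied after shifting the coefficient polynomials (not the
  exponentials) by s, as a polynomial in s; \<open>\<alpha> i\<close> stands for the i-th
  coefficient of P at x. Its derivative in s amounts to d/dy on the coefficients, so Taylor's
  formula in s links stability under d/dy with stability under all shifts.\<close>

definition shift_poly ::
  "(nat \<Rightarrow> complex) \<Rightarrow> nat \<Rightarrow> 'i set \<Rightarrow> ('i \<Rightarrow> complex) \<Rightarrow> complex \<Rightarrow> ('i \<Rightarrow> complex poly) \<Rightarrow> complex poly" where
  "shift_poly \<alpha> d I \<mu> x p =
     (\<Sum>i\<le>d. smult (\<alpha> i) (\<Sum>j\<in>I. smult (exp (\<mu> j * x)) ((twisted_pderiv (\<mu> j) ^^ i) (p j) \<circ>\<^sub>p [:x, 1:])))"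

lemma poly_shift_poly:
  "poly (shift_poly (\<lambda>i. mcoef a d i x) d I \<mu> x p) s = dop a d (quasi_poly I \<mu> (\<lambda>j. p j \<circ>\<^sub>p [:s, 1:])) x"
  by (simp add: shift_poly_def dop_eq_mcoef higher_deriv_qp tw_pcompose quasi_poly_def poly_sum poly_pcompose
      add.commute[of x s] mult.commute)

lemma pderiv_shift_poly:
  "pderiv (shift_poly \<alpha> d I \<mu> x p) = shift_poly \<alpha> d I \<mu> x (\<lambda>j. pderiv (p j))"
  unfolding shift_poly_def higher_pderiv_sum[of 1, simplified] pderiv_smult
  by (simp add: pderiv_pcompose pderiv_pCons pderiv_tw)

lemma poly_eq_0_if_pderivs:
  fixes p :: "complex poly"
  assumes "\<And>l. poly ((pderiv ^^ l) p) 0 = 0"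
  shows "p = 0"
  using assms
proof (induction "degree p" arbitrary: p rule: less_induct)
  case less
  show ?case
  proof (cases "degree p = 0")
    case True
    then obtain c where "p = [:c:]" using degree_eq_zeroE by blast
    then show ?thesis using less.prems[of 0] by simp
  next
    case False
    have "poly ((pderiv ^^ l) (pderiv p)) 0 = 0" for l
      using less.prems[of "Suc l"] by (simp add: funpow_swap1)
    then have "pderiv p = 0" using False by (intro less.hyps) (auto simp: degree_pderiv)
    then show ?thesis using False by (simp add: pderiv_eq_0_iff)
  qed
qed

text \<open>The hypotheses are the values at s = 0 of all derivatives of \<open>shift_poly\<close>,
  which is a polynomial in s and hence vanishes.\<close>

lemma dop_shift_eq_0:
  assumes "\<And>l. dop a d (quasi_poly I \<mu> (\<lambda>j. (pderiv ^^ l) (p j))) x = 0"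
  shows "dop a d (quasi_poly I \<mu> (\<lambda>j. p j \<circ>\<^sub>p [:s, 1:])) x = 0"
proof -
  have "(pderiv ^^ l) (shift_poly (\<lambda>i. mcoef a d i x) d I \<mu> x p)
      = shift_poly (\<lambda>i. mcoef a d i x) d I \<mu> x (\<lambda>j. (pderiv ^^ l) (p j))" for l
    by (induction l) (auto simp: pderiv_shift_poly)
  then have "shift_poly (\<lambda>i. mcoef a d i x) d I \<mu> x p = 0"
    by (intro poly_eq_0_if_pderivs) (simp add: poly_shift_poly assms)
  then show ?thesis by (metis poly_shift_poly poly_0)
qed

text \<open>Shifting each kernel element by -x at the point x removes the polynomial growth, so that the
  linear system for the coefficients of P at x has entries polynomial in exp x.\<close>
lemma trig_coeffs_if_pderiv_closed:
  fixes \<nu> :: "nat \<Rightarrow> 'i \<Rightarrow> nat" and p :: "nat \<Rightarrow> 'i \<Rightarrow> complex poly"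
  assumes U: "open U" "connected U" "U \<noteq> {}" and a: "\<forall>i<d. a i holomorphic_on U"
    and I: "finite I" "inj_on \<mu> I"
    and \<nu>: "\<And>k i. k < d \<Longrightarrow> i \<in> I \<Longrightarrow> p k i \<noteq> 0 \<Longrightarrow> \<mu> i = \<kappa> k + of_nat (\<nu> k i)"
    and closed: "\<And>k x l. k < d \<Longrightarrow> x \<in> U \<Longrightarrow> dop a d (quasi_poly I \<mu> (\<lambda>i. (pderiv ^^ l) (p k i))) x = 0"
    and ind: "\<And>w. (\<And>x. (\<Sum>k<d. w k * quasi_poly I \<mu> (p k) x) = 0) \<Longrightarrow> \<forall>k<d. w k = 0"
  shows "trig_coeffs U a d"
proof -
  \<comment> \<open>The shift by -x replaces the coefficients at x by their values at 0. Factoring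
    exp (\<kappa> k x) out of row k leaves the natural exponents \<open>\<nu> k j\<close>, so the
    entries become polynomials in exp x.\<close>
  define M where "M k i = (\<Sum>j\<in>I. monom (poly ((twisted_pderiv (\<mu> j) ^^ i) (p k j)) 0) (\<nu> k j))" for k i
  define sh where "sh s k = (\<lambda>j. p k j \<circ>\<^sub>p [:s, 1:])" for s k
  have M: "exp (\<kappa> k * x) * poly (M k i) (exp x) = (deriv ^^ i) (quasi_poly I \<mu> (sh (- x) k)) x" if "k < d" for k i x
  proof -
    have "exp (\<kappa> k * x) * (poly ((twisted_pderiv (\<mu> j) ^^ i) (p k j)) 0 * exp x ^ \<nu> k j)
        = poly ((twisted_pderiv (\<mu> j) ^^ i) (p k j)) 0 * exp (\<mu> j * x)" if "j \<in> I" for j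
    proof (cases "p k j = 0")
      case False
      have "exp (\<mu> j * x) = exp (\<kappa> k * x) * exp x ^ \<nu> k j"
        unfolding \<nu>[OF \<open>k < d\<close> that False] by (simp add: exp_add exp_of_nat_mult ring_distribs)
      then show ?thesis by simp
    qed simp
    note eq = this
    show ?thesis
      unfolding M_def poly_sum poly_monom sum_distrib_left higher_deriv_qp quasi_poly_def sh_def tw_pcompose poly_pcompose
      by (intro sum.cong refl) (use eq in simp)
  qed
  \<comment> \<open>Each point x uses its own kernel element: the shift s is fixed before
    differentiating and only then set to -x.\<close>
  have Psh: "dop a d (quasi_poly I \<mu> (sh s k)) x = 0" if "k < d" "x \<in> U" for k s x
    unfolding sh_def by (rule dop_shift_eq_0) (rule closed[OF that])
  obtain x0 where x0: "x0 \<in> U" using U by auto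
  obtain q N where qN: "poly q (exp x0) \<noteq> 0"
    "\<And>j j'. j < d \<Longrightarrow> j' < d \<Longrightarrow> (\<Sum>k<d. N j k * M k j') = (if j = j' then q else 0)"
  proof (rule adjugate_poly[of d M "exp x0"])
    fix w :: "nat \<Rightarrow> complex"
    assume w: "\<And>i. i < d \<Longrightarrow> (\<Sum>k<d. w k * poly (M k i) (exp x0)) = 0"
    \<comment> \<open>Cancels the factors exp (\<kappa> k x0), turning the row relation for
      \<open>M\<close> back into one between jets at \<open>x0\<close>.\<close>
    define w' where "w' k = w k * exp (- \<kappa> k * x0)" for k
    have ww: "w k = w' k * exp (\<kappa> k * x0)" for k by (simp add: w'_def mult.assoc mult_exp_exp)
    define pv where "pv j = (\<Sum>k<d. smult (w' k) (sh (- x0) k j))" for j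
    have v: "quasi_poly I \<mu> pv = (\<lambda>x. \<Sum>k<d. w' k * quasi_poly I \<mu> (sh (- x0) k) x)"
      by (simp add: qp_lin_comb pv_def[abs_def])
    have "quasi_poly I \<mu> pv x = 0" if "x \<in> U" for x
    proof (rule dop_jet_unique[OF U(1,2) a qp_holomorphic _ x0 _ that])
      show "dop a d (quasi_poly I \<mu> pv) x = 0" if "x \<in> U" for x
        unfolding v using that Psh by (subst dop_lin_comb[OF U(1) that]) (auto intro: qp_holomorphic)
      show "(deriv ^^ i) (quasi_poly I \<mu> pv) x0 = 0" if "i < d" for i
      proof -
        have "(deriv ^^ i) (quasi_poly I \<mu> pv) x0 = (\<Sum>k<d. w' k * (deriv ^^ i) (quasi_poly I \<mu> (sh (- x0) k)) x0)"
          unfolding v by (rule higher_deriv_lin_comb[OF U(1) x0]) (rule qp_holomorphic)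
        also have "\<dots> = (\<Sum>k<d. w k * poly (M k i) (exp x0))"
          by (intro sum.cong refl) (simp add: M[symmetric] ww)
        finally show ?thesis using w[OF that] by simp
      qed
    qed
    then have pv0: "pv j = 0" if "j \<in> I" for j using qp_eq_0_imp[OF I U(1,3) _ that] by blast
    \<comment> \<open>Shifting back by \<open>x0\<close> carries the relation over to the original
      coefficients, where \<open>ind\<close> applies.\<close>
    have "(\<Sum>k<d. smult (w' k) (p k j)) = 0" if "j \<in> I" for j
    proof -
      have "p k j = sh (- x0) k j \<circ>\<^sub>p [:x0, 1:]" for k
        by (simp add: sh_def pcompose_assoc[symmetric] pcompose_pCons pcompose_idR)
      then have "(\<Sum>k<d. smult (w' k) (p k j)) = pv j \<circ>\<^sub>p [:x0, 1:]"
        by (simp add: pv_def pcompose_sum pcompose_smult)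
      then show ?thesis using pv0[OF that] by simp
    qed
    then have "(\<Sum>k<d. w' k * quasi_poly I \<mu> (p k) x) = 0" for x
      unfolding qp_lin_comb by (simp add: quasi_poly_def)
    then show "\<forall>k<d. w k = 0" using ind ww by simp
  qed blast
  show ?thesis
    unfolding trig_coeffs_def
  proof (intro allI impI exI conjI ballI)
    show "q \<noteq> 0" using qN(1) by auto
    fix j x assume j: "j < d" and x: "x \<in> U" "poly q (exp x) \<noteq> 0"
    have eq: "(\<Sum>i<d. a i x * poly (M k i) (exp x)) = - poly (M k d) (exp x)" if k: "k < d" for k
    proof -
      have "exp (\<kappa> k * x) * ((\<Sum>i<d. a i x * poly (M k i) (exp x)) + poly (M k d) (exp x))
          = (deriv ^^ d) (quasi_poly I \<mu> (sh (- x) k)) x + (\<Sum>i<d. a i x * (deriv ^^ i) (quasi_poly I \<mu> (sh (- x) k)) x)"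
        by (simp add: M[OF k, symmetric] ring_distribs sum_distrib_left mult_ac)
      also have "\<dots> = 0" using Psh[OF k x(1)] by (simp add: dop_def)
      finally show ?thesis by (simp add: add_eq_0_iff2)
    qed
    \<comment> \<open>Multiplying the system by row j of the adjugate isolates q(exp x)
      a_j(x).\<close>
    have "poly q (exp x) * a j x = (\<Sum>i<d. a i x * poly (if j = i then q else 0) (exp x))"
    proof -
      have "(\<Sum>i<d. a i x * poly (if j = i then q else 0) (exp x)) = (\<Sum>i<d. if j = i then a i x * poly q (exp x) else 0)"
        by (intro sum.cong) auto
      then show ?thesis using j by simp
    qed
    also have "\<dots> = (\<Sum>i<d. \<Sum>k<d. poly (N j k) (exp x) * (a i x * poly (M k i) (exp x)))"
      using qN(2)[OF j, symmetric] by (simp add: poly_sum sum_distrib_left mult_ac)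
    also have "\<dots> = (\<Sum>k<d. \<Sum>i<d. poly (N j k) (exp x) * (a i x * poly (M k i) (exp x)))"
      by (rule sum.swap)
    also have "\<dots> = (\<Sum>k<d. poly (N j k) (exp x) * (- poly (M k d) (exp x)))"
      unfolding sum_distrib_left[symmetric] using eq by (intro sum.cong) auto
    also have "\<dots> = poly (- (\<Sum>k<d. N j k * M k d)) (exp x)"
      by (simp add: poly_sum sum_negf)
    finally show "a j x = poly (- (\<Sum>k<d. N j k * M k d)) (exp x) / poly q (exp x)"
      using x(2) by (simp add: field_simps)
  qed
qed

section \<open>Functions rational in exp x, and the left factor Q\<close>

definition trig_fun :: "complex set \<Rightarrow> (complex \<Rightarrow> complex) \<Rightarrow> bool" where
  "trig_fun U f \<longleftrightarrow> (\<exists>p q :: complex poly. q \<noteq> 0 \<and>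
        (\<forall>x\<in>U. poly q (exp x) \<noteq> 0 \<longrightarrow> f x = poly p (exp x) / poly q (exp x)))"

lemma trig_coeffs_iff: "trig_coeffs U a d \<longleftrightarrow> (\<forall>i<d. trig_fun U (a i))"
  by (simp add: trig_coeffs_def trig_fun_def)

lemma trig_fun_const: "trig_fun U (\<lambda>x. c)"
  unfolding trig_fun_def by (intro exI[of _ "[:c:]"] exI[of _ 1]) auto

lemma trig_fun_cong: "(\<And>x. x \<in> U \<Longrightarrow> f x = g x) \<Longrightarrow> trig_fun U f \<longleftrightarrow> trig_fun U g"
  unfolding trig_fun_def by auto

lemma trig_fun_add:
  assumes "trig_fun U f" "trig_fun U g"
  shows "trig_fun U (\<lambda>x. f x + g x)"
proof -
  obtain p q p' q' where "q \<noteq> 0" "\<forall>x\<in>U. poly q (exp x) \<noteq> 0 \<longrightarrow> f x = poly p (exp x) / poly q (exp x)"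
    "q' \<noteq> 0" "\<forall>x\<in>U. poly q' (exp x) \<noteq> 0 \<longrightarrow> g x = poly p' (exp x) / poly q' (exp x)"
    using assms unfolding trig_fun_def by blast
  then show ?thesis unfolding trig_fun_def
    by (intro exI[of _ "p * q' + p' * q"] exI[of _ "q * q'"]) (auto simp: field_simps)
qed

lemma trig_fun_mult:
  assumes "trig_fun U f" "trig_fun U g"
  shows "trig_fun U (\<lambda>x. f x * g x)"
proof -
  obtain p q p' q' where "q \<noteq> 0" "\<forall>x\<in>U. poly q (exp x) \<noteq> 0 \<longrightarrow> f x = poly p (exp x) / poly q (exp x)"
    "q' \<noteq> 0" "\<forall>x\<in>U. poly q' (exp x) \<noteq> 0 \<longrightarrow> g x = poly p' (exp x) / poly q' (exp x)"
    using assms unfolding trig_fun_def by blast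
  then show ?thesis unfolding trig_fun_def
    by (intro exI[of _ "p * p'"] exI[of _ "q * q'"]) auto
qed

lemma trig_fun_sum: "(\<And>i. i \<in> A \<Longrightarrow> trig_fun U (f i)) \<Longrightarrow> trig_fun U (\<lambda>x. \<Sum>i\<in>A. f i x)"
  by (induction A rule: infinite_finite_induct) (auto intro: trig_fun_add trig_fun_const)

text \<open>The derivative of R(exp x) is exp x R'(exp x); the factor \<open>[:0, 1:]\<close> in the
  witness is this exp x.\<close>

lemma trig_fun_deriv:
  assumes U: "open U" and f: "trig_fun U f"
  shows "trig_fun U (deriv f)"
proof -
  obtain p q where q: "q \<noteq> 0" and pq: "\<And>x. x \<in> U \<Longrightarrow> poly q (exp x) \<noteq> 0 \<Longrightarrow> f x = poly p (exp x) / poly q (exp x)"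
    using f unfolding trig_fun_def by blast
  show ?thesis unfolding trig_fun_def
  proof (intro exI conjI ballI impI)
    show "q * q \<noteq> 0" using q by simp
    fix x assume x: "x \<in> U" "poly (q * q) (exp x) \<noteq> 0"
    \<comment> \<open>The quotient formula for \<open>f\<close> must hold in a neighbourhood before
      it can be differentiated.\<close>
    define V where "V = {x \<in> U. poly q (exp x) \<noteq> 0}"
    have "open V"
    proof -
      have "V = U \<inter> (\<lambda>x. poly q (exp x)) -` (- {0})" by (auto simp: V_def)
      then show ?thesis using U by (auto intro!: open_vimage continuous_intros)
    qed
    have "((\<lambda>x. poly p (exp x) / poly q (exp x)) has_field_derivative
        (poly (pderiv p) (exp x) * exp x * poly q (exp x) - poly p (exp x) * (poly (pderiv q) (exp x) * exp x))
          / (poly q (exp x) * poly q (exp x))) (at x)"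
      using x by (auto intro!: derivative_eq_intros DERIV_chain2[OF poly_DERIV])
    then have "(f has_field_derivative
        (poly (pderiv p) (exp x) * exp x * poly q (exp x) - poly p (exp x) * (poly (pderiv q) (exp x) * exp x))
          / (poly q (exp x) * poly q (exp x))) (at x)"
      using \<open>open V\<close> by (rule has_field_derivative_transform_within_open) (use x pq in \<open>auto simp: V_def\<close>)
    then show "deriv f x = poly ([:0, 1:] * (pderiv p * q - p * pderiv q)) (exp x) / poly (q * q) (exp x)"
      by (simp add: DERIV_imp_deriv algebra_simps)
  qed
qed

lemma trig_fun_higher_deriv: "open U \<Longrightarrow> trig_fun U f \<Longrightarrow> trig_fun U ((deriv ^^ k) f)"
  by (induction k) (auto intro: trig_fun_deriv)

text \<open>Comparing coefficients in Q P = f g determines the coefficients of Q recursively from the top.\<close>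
lemma trig_coeffs_left_factor:
  assumes U: "open U" and D: "darboux_data U f g a d b e" and a: "trig_coeffs U a d"
  shows "trig_coeffs U b e"
proof -
  have ma: "trig_fun U (mcoef a d i)" for i
    using a by (auto simp: mcoef_def trig_coeffs_iff intro: trig_fun_const)
  have "trig_fun U (mcoef b e k)" if "k \<le> e" for k
    using that
  proof (induction "e - k" arbitrary: k rule: less_induct)
    case less
    have IH: "trig_fun U (mcoef b e j)" if "j \<in> {k<..e}" for j
      using that by (intro less.hyps) auto
    have "trig_fun U (\<lambda>x. coeff (f * g) (d + k) + (- 1) * (\<Sum>j\<in>{k<..e}. \<Sum>i\<le>d. \<Sum>t\<le>j.
       if i + t = d + k then mcoef b e j x * of_nat (j choose t) * (deriv ^^ (j - t)) (mcoef a d i) x else 0))"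
      (is "trig_fun U ?F")
    proof (intro trig_fun_add trig_fun_mult trig_fun_const trig_fun_sum)
      fix j i t assume "j \<in> {k<..e}"
      then show "trig_fun U (\<lambda>x. if i + t = d + k then mcoef b e j x * of_nat (j choose t) * (deriv ^^ (j - t)) (mcoef a d i) x else 0)"
        by (cases "i + t = d + k")
          (auto intro!: trig_fun_mult trig_fun_const IH trig_fun_higher_deriv[OF U] ma)
    qed
    moreover have "mcoef b e k x = ?F x" if "x \<in> U" for x
      using coeff_comp_symbol[OF less.prems, of b a d x] darboux_symbol[OF U D that] by simp
    ultimately show ?case using trig_fun_cong[of U "mcoef b e k" ?F] by blast
  qed
  then show ?thesis unfolding trig_coeffs_iff mcoef_def by (metis less_imp_le)
qed

subsection \<open>String bases\<close>

lemma coeff_higher_pderiv':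
  "coeff ((pderiv ^^ m) p) k = (fact (k + m) / fact k) * coeff (p :: complex poly) (k + m)"
proof (induction m arbitrary: k)
  case (Suc m)
  have A: "coeff ((pderiv ^^ Suc m) p) k = of_nat (Suc k) * ((fact (Suc k + m) / fact (Suc k)) * coeff p (Suc k + m))"
    by (simp only: funpow.simps o_apply coeff_pderiv Suc.IH)
  have B: "of_nat (Suc k) * (fact (Suc k + m) / fact (Suc k)) = (fact (k + Suc m) / fact k :: complex)"
    by (simp only: fact_Suc[of k] of_nat_mult) (simp del: of_nat_Suc)
  show ?case unfolding A mult.assoc[symmetric] B by simp
qed simp

lemma higher_pderiv_eq_0: "degree (p :: complex poly) < l \<Longrightarrow> (pderiv ^^ l) p = 0"
  by (rule poly_eqI) (simp add: coeff_higher_pderiv' coeff_eq_0)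

lemma higher_pderiv_smult: "(pderiv ^^ l) (smult c p) = smult c ((pderiv ^^ l) p)"
  by (induction l) (auto simp: pderiv_smult)

lemma fspan_eq_span: "finite B \<Longrightarrow> fspan B = fvs.span B"
  using fvs_span_iff[of B] by (auto simp: fspan_def fun_eq_iff)

text \<open>The coefficient of s^l in c(y + s), that is, the l-th member of the string generated by
  c.\<close>

definition taylor_coeff :: "nat \<Rightarrow> (nat \<Rightarrow> complex poly) \<Rightarrow> nat \<Rightarrow> complex poly" where
  "taylor_coeff l c = (\<lambda>j. smult (1 / fact l) ((pderiv ^^ l) (c j)))"

lemma block_eq: "block lam N c = (\<lambda>l. quasi_poly {..N} (\<lambda>j. lam - of_nat j) (taylor_coeff l c)) ` {..l0 N c}"
  by (auto simp: block_def quasi_poly_def[abs_def] taylor_coeff_def)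

lemma finite_basis_union: "finite (basis_union lam N cs)"
  by (simp add: basis_union_def block_eq)

lemma degree_le_l0:
  assumes "j \<le> N" "c j \<noteq> 0"
  shows "degree (c j) \<le> l0 N c"
  unfolding l0_def using assms by (intro Max_ge) auto

lemma tail_eq_0: "j \<le> N \<Longrightarrow> l0 N c < l \<Longrightarrow> taylor_coeff l c j = 0"
  using degree_le_l0[of j N c] by (cases "c j = 0") (auto simp: taylor_coeff_def higher_pderiv_eq_0)

text \<open>Together with \<open>tail_eq_0\<close> this makes the span of a string stable under
  d/dy: a derivative of a member is a multiple of a later member, or 0 past the end.\<close>

lemma higher_pderiv_tail: "(pderiv ^^ l') (taylor_coeff l c j) = smult (fact (l' + l) / fact l) (taylor_coeff (l' + l) c j)"
  by (simp add: taylor_coeff_def higher_pderiv_smult funpow_add)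

text \<open>The coefficient side of one class. The common degree bound makes d/dy nilpotent on
  \<open>V\<close>. Tuples are used instead of functions so that d/dy acts on them directly.\<close>

locale poly_family_space =
  fixes N D :: nat and V :: "(nat \<Rightarrow> complex poly) set"
  assumes supp: "\<And>c j. c \<in> V \<Longrightarrow> N < j \<Longrightarrow> c j = 0"
    and degree_bound: "\<And>c j. c \<in> V \<Longrightarrow> degree (c j) < D"
    and zero_mem: "(\<lambda>j. 0) \<in> V"
    and add_mem: "\<And>c c'. c \<in> V \<Longrightarrow> c' \<in> V \<Longrightarrow> (\<lambda>j. c j + c' j) \<in> V"
    and smult_mem: "\<And>c k. c \<in> V \<Longrightarrow> (\<lambda>j. smult k (c j)) \<in> V"
    and pderiv_mem: "\<And>c. c \<in> V \<Longrightarrow> (\<lambda>j. pderiv (c j)) \<in> V"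
begin

lemma tail_mem: "c \<in> V \<Longrightarrow> taylor_coeff l c \<in> V"
proof -
  assume c: "c \<in> V"
  have "(\<lambda>j. (pderiv ^^ l) (c j)) \<in> V" by (induction l) (auto intro: pderiv_mem c)
  then show ?thesis unfolding taylor_coeff_def by (rule smult_mem)
qed

lemma sum_mem: "(\<And>k. k \<in> A \<Longrightarrow> c k \<in> V) \<Longrightarrow> (\<lambda>j. \<Sum>k\<in>A. c k j) \<in> V"
  by (induction A rule: infinite_finite_induct) (auto intro: zero_mem add_mem)

lemma subspace_qp: "fvs.subspace (quasi_poly I \<mu> ` V)"
proof (rule fvs.subspaceI)
  show "0 \<in> quasi_poly I \<mu> ` V" using zero_mem by (intro image_eqI[of _ _ "\<lambda>j. 0"]) (auto simp: fun_eq_iff)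
next
  fix x y assume "x \<in> quasi_poly I \<mu> ` V" "y \<in> quasi_poly I \<mu> ` V"
  then obtain c c' where c: "c \<in> V" "c' \<in> V" "x = quasi_poly I \<mu> c" "y = quasi_poly I \<mu> c'" by auto
  then have "x + y = quasi_poly I \<mu> (\<lambda>j. c j + c' j)" by (simp add: fun_eq_iff qp_add)
  then show "x + y \<in> quasi_poly I \<mu> ` V" using add_mem c by blast
next
  fix k x assume "x \<in> quasi_poly I \<mu> ` V"
  then obtain c where c: "c \<in> V" "x = quasi_poly I \<mu> c" by auto
  then have "fun_scale k x = quasi_poly I \<mu> (\<lambda>j. smult k (c j))" by (simp add: fun_eq_iff qp_smult fun_scale_def)
  then show "fun_scale k x \<in> quasi_poly I \<mu> ` V" using smult_mem c by blast
qed

text \<open>Tuples of degree below l contribute the zero vector, so \<open>lead l\<close> models the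
  tuples of degree at most l modulo those of degree less than l, that is, ker (d/dy)^(l+1) modulo
  ker (d/dy)^l on \<open>V\<close>.\<close>

definition lead :: "nat \<Rightarrow> (nat \<Rightarrow> complex) set" where
  "lead l = {(\<lambda>j. coeff (c j) l) | c. c \<in> V \<and> (\<forall>j. degree (c j) \<le> l)}"

text \<open>Differentiating and dividing by l + 1 keeps the top coefficients, one degree lower. So
  the spaces form a decreasing flag.\<close>

lemma lead_Suc_subset: "lead (Suc l) \<subseteq> lead l"
proof
  fix s assume "s \<in> lead (Suc l)"
  then obtain c where c: "c \<in> V" "\<forall>j. degree (c j) \<le> Suc l" "s = (\<lambda>j. coeff (c j) (Suc l))"
    unfolding lead_def by blast
  have "(\<lambda>j. smult (1 / of_nat (Suc l)) (pderiv (c j))) \<in> V" by (intro smult_mem pderiv_mem c)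
  moreover have "degree (smult (1 / of_nat (Suc l)) (pderiv (c j))) \<le> l" for j
    using c(2)[rule_format, of j] by (auto simp: degree_pderiv)
  moreover have "s = (\<lambda>j. coeff (smult (1 / of_nat (Suc l)) (pderiv (c j))) l)"
    by (simp add: c(3) coeff_pderiv del: of_nat_Suc)
  ultimately show "s \<in> lead l" unfolding lead_def
    by (intro CollectI exI[of _ "\<lambda>j. smult (1 / of_nat (Suc l)) (pderiv (c j))"]) blast
qed

lemma lead_trivial: "D \<le> l \<Longrightarrow> lead l \<subseteq> {0}"
proof
  fix s assume D: "D \<le> l" and "s \<in> lead l"
  then obtain c where c: "c \<in> V" "s = (\<lambda>j. coeff (c j) l)" unfolding lead_def by blast
  have "coeff (c j) l = 0" for j using degree_bound[OF c(1), of j] D by (simp add: coeff_eq_0)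
  then show "s \<in> {0}" using c(2) by (simp add: fun_eq_iff)
qed

text \<open>The construction starts where the flag is trivial and extends the basis at each step to
  the next larger space, so one set contains a basis of every \<open>lead k\<close> with k \<ge>
  l.\<close>

lemma ex_flag_basis:
  "\<exists>B \<subseteq> lead l. fvs.independent B \<and> (\<forall>k\<ge>l. lead k \<subseteq> fvs.span (B \<inter> lead k))"
proof (induction "D - l" arbitrary: l)
  case 0
  then have "lead k \<subseteq> fvs.span ({} \<inter> lead k)" if "k \<ge> l" for k using lead_trivial[of k] that by auto
  then show ?case using fvs.independent_empty by blast
next
  case (Suc n)
  have "n = D - Suc l" using Suc.hyps(2) by simp
  then obtain B where B: "B \<subseteq> lead (Suc l)" "fvs.independent B"
    "\<And>k. k \<ge> Suc l \<Longrightarrow> lead k \<subseteq> fvs.span (B \<inter> lead k)"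
    using Suc.hyps(1)[of "Suc l"] by blast
  have "B \<subseteq> lead l" using B(1) lead_Suc_subset by blast
  then obtain B' where B': "B \<subseteq> B'" "B' \<subseteq> lead l" "fvs.independent B'" "lead l \<subseteq> fvs.span B'"
    using fvs.maximal_independent_subset_extend[OF _ B(2)] by metis
  have "lead k \<subseteq> fvs.span (B' \<inter> lead k)" if "k \<ge> l" for k
  proof (cases "k = l")
    case True
    then show ?thesis using B'(2,4) by (simp add: Int_absorb2)
  next
    case False
    then have "lead k \<subseteq> fvs.span (B \<inter> lead k)" using that B(3) by simp
    also have "\<dots> \<subseteq> fvs.span (B' \<inter> lead k)" using B'(1) by (intro fvs.span_mono) auto
    finally show ?thesis .
  qed
  then show ?case using B' by blast
qed

text \<open>Differentiation of coefficients is nilpotent on V. A Jordan basis is read off from a basis of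
  leading coefficient vectors adapted to the flag lead 0, lead 1, ...\<close>
lemma ex_string_basis:
  "\<exists>cs. (\<forall>c\<in>set cs. c \<in> V \<and> c \<noteq> (\<lambda>j. 0)) \<and> lin_indep (basis_union lam N cs)
      \<and> fspan (basis_union lam N cs) = quasi_poly {..N} (\<lambda>j. lam - of_nat j) ` V"
proof -
  define \<mu> where "\<mu> = (\<lambda>j::nat. lam - of_nat j)"
  have inj: "inj_on \<mu> {..N}" by (auto simp: \<mu>_def inj_on_def)
  obtain B where B: "B \<subseteq> lead 0" "fvs.independent B" "\<And>k. lead k \<subseteq> fvs.span (B \<inter> lead k)"
    using ex_flag_basis[of 0] by auto
  have finB: "finite B"
  proof -
    define E :: "nat \<Rightarrow> nat \<Rightarrow> complex" where "E i = (\<lambda>j. if j = i then 1 else 0)" for i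
    have "s \<in> fvs.span (E ` {..N})" if "s \<in> lead 0" for s
    proof -
      obtain c where c: "c \<in> V" "s = (\<lambda>j. coeff (c j) 0)" using \<open>s \<in> lead 0\<close> unfolding lead_def by blast
      have "s j = (\<Sum>i\<le>N. fun_scale (s i) (E i)) j" for j
        using supp[OF c(1), of j] by (cases "j \<le> N") (auto simp: sum_scl_apply E_def c(2) if_distrib sum.delta cong: if_cong)
      then have "s = (\<Sum>i\<le>N. fun_scale (s i) (E i))" by blast
      also have "\<dots> \<in> fvs.span (E ` {..N})"
        by (rule fvs.span_sum, rule fvs.span_scale, rule fvs.span_base, rule imageI)
      finally show ?thesis .
    qed
    then show ?thesis using fvs.independent_span_bound[OF _ B(2), of "E ` {..N}"] B(1) by blast
  qed
  have B0: "s \<noteq> 0" if "s \<in> B" for s using B(2) that fvs.dependent_zero by blast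
  \<comment> \<open>\<open>lev s\<close> is the deepest flag space containing s. It becomes the top
    degree of the string over s, which thus has \<open>lev s + 1\<close> members.\<close>
  have "\<exists>lev. s \<in> lead lev \<and> (\<forall>k. s \<in> lead k \<longrightarrow> k \<le> lev)" if s: "s \<in> B" for s
  proof -
    have "s \<in> lead k \<Longrightarrow> k \<le> D" for k using lead_trivial[of k] B0[OF s] by fastforce
    then show ?thesis using GreatestI_nat[of "\<lambda>k. s \<in> lead k" 0 D] Greatest_le_nat[of "\<lambda>k. s \<in> lead k" _ D] B(1) s
      by (intro exI[of _ "GREATEST k. s \<in> lead k"]) blast
  qed
  then obtain lev where lev: "\<And>s. s \<in> B \<Longrightarrow> s \<in> lead (lev s)" "\<And>s k. s \<in> B \<Longrightarrow> s \<in> lead k \<Longrightarrow> k \<le> lev s"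
    by metis
  have "\<exists>c. c \<in> V \<and> (\<forall>j. degree (c j) \<le> lev s \<and> coeff (c j) (lev s) = s j)" if sB: "s \<in> B" for s
  proof -
    obtain c where c: "c \<in> V" "\<forall>j. degree (c j) \<le> lev s" "s = (\<lambda>j. coeff (c j) (lev s))"
      using lev(1)[OF sB] unfolding lead_def by blast
    have "coeff (c j) (lev s) = s j" for j using fun_cong[OF c(3), of j] by simp
    then show ?thesis using c(1,2) by blast
  qed
  then obtain C where C: "\<And>s. s \<in> B \<Longrightarrow> C s \<in> V" "\<And>s j. s \<in> B \<Longrightarrow> degree (C s j) \<le> lev s"
     "\<And>s j. s \<in> B \<Longrightarrow> coeff (C s j) (lev s) = s j"
    by metis
  have tail_coeff: "coeff (taylor_coeff l (C s) j) k = (if lev s < k + l then 0 else fact (k + l) / (fact k * fact l) * coeff (C s j) (k + l))"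
    if "s \<in> B" for s l j k
    using C(2)[OF that, of j] by (auto simp: taylor_coeff_def coeff_higher_pderiv' coeff_eq_0)
  have nz: "\<exists>j\<le>N. C s j \<noteq> 0" if s: "s \<in> B" for s
  proof -
    obtain j where "s j \<noteq> 0" using B0[OF s] by (auto simp: fun_eq_iff)
    then have "C s j \<noteq> 0" using C(3)[OF s, of j] by auto
    then show ?thesis using supp[OF C(1)[OF s], of j] by (meson not_le_imp_less)
  qed
  have l0: "l0 N (C s) = lev s" if s: "s \<in> B" for s
  proof (rule antisym)
    show "l0 N (C s) \<le> lev s" unfolding l0_def using nz[OF s] C(2)[OF s] by (subst Max_le_iff) auto
    obtain j where "s j \<noteq> 0" using B0[OF s] by (auto simp: fun_eq_iff)
    then have *: "coeff (C s j) (lev s) \<noteq> 0" using C(3)[OF s, of j] by auto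
    then have "C s j \<noteq> 0" by auto
    then have "degree (C s j) \<le> l0 N (C s)" using supp[OF C(1)[OF s], of j] by (intro degree_le_l0) (meson not_le_imp_less)
    then show "lev s \<le> l0 N (C s)" using le_degree[OF *] by simp
  qed
  obtain cs where cs: "set cs = C ` B" using finite_list[of "C ` B"] finB by auto
  define J where "J = Sigma B (\<lambda>s. {..lev s})"
  define F where "F = (\<lambda>j. quasi_poly {..N} \<mu> (taylor_coeff (snd j) (C (fst j))))"
  have finJ: "finite J" using finB by (simp add: J_def)
  have bu: "basis_union lam N cs = F ` J"
  proof -
    have "basis_union lam N cs = (\<Union>s\<in>B. (\<lambda>l. quasi_poly {..N} \<mu> (taylor_coeff l (C s))) ` {..lev s})"
      unfolding basis_union_def cs block_eq \<mu>_def using l0 by auto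
    also have "\<dots> = F ` J"
    proof (intro equalityI subsetI)
      fix u assume "u \<in> (\<Union>s\<in>B. (\<lambda>l. quasi_poly {..N} \<mu> (taylor_coeff l (C s))) ` {..lev s})"
      then obtain s l where "s \<in> B" "l \<le> lev s" "u = F (s, l)" by (auto simp: F_def)
      then show "u \<in> F ` J" by (auto simp: J_def)
    next
      fix u assume "u \<in> F ` J"
      then obtain s l where "s \<in> B" "l \<le> lev s" "u = F (s, l)" by (auto simp: J_def)
      then show "u \<in> (\<Union>s\<in>B. (\<lambda>l. quasi_poly {..N} \<mu> (taylor_coeff l (C s))) ` {..lev s})" by (auto simp: F_def)
    qed
    finally show ?thesis .
  qed
  have indep: "\<forall>j\<in>J. w j = 0" if w: "\<And>x. (\<Sum>j\<in>J. w j * F j x) = 0" for w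
  proof -
    have z: "(\<Sum>i\<in>J. smult (w i) (taylor_coeff (snd i) (C (fst i)) j)) = 0" for j
    proof (cases "j \<le> N")
      case True
      have "quasi_poly {..N} \<mu> (\<lambda>j. \<Sum>i\<in>J. smult (w i) (taylor_coeff (snd i) (C (fst i)) j)) x = 0" for x
        using w[of x] unfolding F_def qp_lin_comb .
      then show ?thesis using qp_eq_0_imp[OF _ inj open_UNIV] True by blast
    next
      case False
      then show ?thesis using supp[OF tail_mem[OF C(1)]] by (intro sum.neutral) (auto simp: J_def)
    qed
    \<comment> \<open>By descending degree k. In the coefficients of y^k, members of degree below k
      are invisible and those of degree above k already have weight 0; what remains is a relation
      between the vectors in \<open>B\<close>.\<close>
    have "\<forall>s\<in>B. k \<le> lev s \<longrightarrow> w (s, lev s - k) = 0" for k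
    proof (induction "D - k" arbitrary: k rule: less_induct)
      case less
      have IH: "w (s, l) = 0" if "s \<in> B" "l \<le> lev s" "k < lev s - l" for s l
      proof -
        have "lev s \<le> D" using lead_trivial[of "lev s"] lev(1)[OF that(1)] B0[OF that(1)] by (cases "lev s \<le> D") auto
        then have "D - (lev s - l) < D - k" using that(3) by linarith
        then show ?thesis using less[of "lev s - l"] that by (auto simp: diff_diff_cancel)
      qed
      \<comment> \<open>The quotient of factorials is the binomial coefficient C(lev s, k), the top
        coefficient of the (lev s - k)-th Taylor coefficient of y^(lev s).\<close>
      define u where "u s = (if k \<le> lev s then w (s, lev s - k) * (fact (lev s) / (fact k * fact (lev s - k))) else 0)" for s
      have "(\<Sum>s\<in>B. u s * s j) = 0" for j
      proof -
        have "(\<Sum>l\<le>lev s. w (s, l) * coeff (taylor_coeff l (C s) j) k) = u s * s j" if s: "s \<in> B" for s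
        proof (cases "k \<le> lev s")
          case True
          have "(\<Sum>l\<le>lev s. w (s, l) * coeff (taylor_coeff l (C s) j) k)
              = (\<Sum>l\<in>{lev s - k}. w (s, l) * coeff (taylor_coeff l (C s) j) k)"
          proof (rule sum.mono_neutral_right)
            show "\<forall>l\<in>{..lev s} - {lev s - k}. w (s, l) * coeff (taylor_coeff l (C s) j) k = 0"
            proof
              fix l assume l: "l \<in> {..lev s} - {lev s - k}"
              then consider "lev s < k + l" | "k < lev s - l" by force
              then show "w (s, l) * coeff (taylor_coeff l (C s) j) k = 0"
                using IH[OF s, of l] l tail_coeff[OF s, of l j k] by cases auto
            qed
          qed auto
          then show ?thesis using True by (simp add: u_def tail_coeff[OF s] C(3)[OF s])
        next
          case False
          then show ?thesis by (simp add: u_def tail_coeff[OF s])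
        qed
        then have "(\<Sum>s\<in>B. u s * s j) = (\<Sum>s\<in>B. \<Sum>l\<le>lev s. w (s, l) * coeff (taylor_coeff l (C s) j) k)"
          by simp
        also have "\<dots> = coeff (\<Sum>i\<in>J. smult (w i) (taylor_coeff (snd i) (C (fst i)) j)) k"
          using finB by (simp add: J_def sum.Sigma coeff_sum case_prod_beta)
        finally show ?thesis by (simp add: z)
      qed
      then have "\<forall>s\<in>B. u s = 0" using B(2) fvs_indep_iff[OF finB] by blast
      then show ?case by (auto simp: u_def)
    qed
    note * = this
    show ?thesis
    proof
      fix i assume "i \<in> J"
      then obtain s l where i: "i = (s, l)" "s \<in> B" "l \<le> lev s" by (auto simp: J_def)
      then show "w i = 0" using *[of "lev s - l"] by auto
    qed
  qed
  note ind = fvs_indep_family[of J F, OF finJ indep]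
  \<comment> \<open>Induction on a degree bound. The coefficients of y^k are expanded in the part of
    \<open>B\<close> inside \<open>lead k\<close>, and the string members of degree k with these top
    vectors are subtracted.\<close>
  have "quasi_poly {..N} \<mu> c \<in> fvs.span (F ` J)" if "c \<in> V" "\<And>j. c j = 0 \<or> degree (c j) < k" for c k
    using that
  proof (induction k arbitrary: c)
    case 0
    then have "quasi_poly {..N} \<mu> c = 0" by (simp add: quasi_poly_def fun_eq_iff)
    then show ?case by (simp only: fvs.span_zero)
  next
    case (Suc k)
    have "degree (c j) \<le> k" for j using Suc.prems(2)[of j] by auto
    then have "(\<lambda>j. coeff (c j) k) \<in> lead k" unfolding lead_def using Suc.prems(1) by blast
    then have "(\<lambda>j. coeff (c j) k) \<in> fvs.span (B \<inter> lead k)" using B(3) by blast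
    then obtain w where w: "\<And>j. coeff (c j) k = (\<Sum>s\<in>B \<inter> lead k. w s * s j)"
      using fvs_span_iff[of "B \<inter> lead k"] finB by auto
    \<comment> \<open>Undoes the binomial factor C(lev s, k) in the top coefficient of
      \<open>t s\<close>.\<close>
    define y where "y s = w s * (fact k * fact (lev s - k) / fact (lev s))" for s
    define t where "t s = taylor_coeff (lev s - k) (C s)" for s
    have kl: "k \<le> lev s" if "s \<in> B \<inter> lead k" for s using lev(2) that by blast
    have tk: "coeff (t s j) i = (if i = k then fact (lev s) / (fact k * fact (lev s - k)) * s j else 0)"
      if "s \<in> B \<inter> lead k" "k \<le> i" for s j i
      using tail_coeff[of s "lev s - k" j i] kl[OF that(1)] that C(3)[of s j] by (auto simp: t_def)
    define c' where "c' j = c j + (\<Sum>s\<in>B \<inter> lead k. smult (- y s) (t s j))" for j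
    have c': "c' \<in> V" unfolding c'_def[abs_def] t_def
      by (intro add_mem sum_mem smult_mem tail_mem Suc.prems C) auto
    have "coeff (c' j) i = 0" if "k \<le> i" for i j
    proof (cases "i = k")
      case True
      then have "coeff (c' j) i = (\<Sum>s\<in>B \<inter> lead k. w s * s j) + (\<Sum>s\<in>B \<inter> lead k. - (w s * s j))"
        by (simp add: c'_def w coeff_sum tk y_def)
      then show ?thesis by (simp add: sum_negf)
    next
      case False
      then show ?thesis using that \<open>\<And>j. degree (c j) \<le> k\<close>[of j]
        by (simp add: c'_def coeff_sum tk coeff_eq_0)
    qed
    then have "c' j = 0 \<or> degree (c' j) < k" for j
      by (metis leading_coeff_0_iff not_le_imp_less)
    then have IH: "quasi_poly {..N} \<mu> c' \<in> fvs.span (F ` J)" using Suc.IH c' by blast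
    have "quasi_poly {..N} \<mu> c = quasi_poly {..N} \<mu> c' + (\<Sum>s\<in>B \<inter> lead k. fun_scale (y s) (F (s, lev s - k)))"
    proof
      fix x
      have "(quasi_poly {..N} \<mu> c' + (\<Sum>s\<in>B \<inter> lead k. fun_scale (y s) (F (s, lev s - k)))) x
          = quasi_poly {..N} \<mu> c' x + (\<Sum>s\<in>B \<inter> lead k. y s * quasi_poly {..N} \<mu> (t s) x)"
        by (simp add: sum_scl_apply F_def t_def)
      also have "\<dots> = quasi_poly {..N} \<mu> (\<lambda>j. c' j + (\<Sum>s\<in>B \<inter> lead k. smult (y s) (t s j))) x"
        unfolding qp_lin_comb qp_add ..
      also have "(\<lambda>j. c' j + (\<Sum>s\<in>B \<inter> lead k. smult (y s) (t s j))) = c"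
        by (simp add: c'_def[abs_def] sum_negf)
      finally show "quasi_poly {..N} \<mu> c x = (quasi_poly {..N} \<mu> c' + (\<Sum>s\<in>B \<inter> lead k. fun_scale (y s) (F (s, lev s - k)))) x" ..
    qed
    also have "\<dots> \<in> fvs.span (F ` J)"
    proof (rule fvs.span_add[OF IH], rule fvs.span_sum, rule fvs.span_scale, rule fvs.span_base, rule imageI)
      fix s assume "s \<in> B \<inter> lead k"
      then show "(s, lev s - k) \<in> J" by (auto simp: J_def)
    qed
    finally show ?case .
  qed
  then have "quasi_poly {..N} \<mu> ` V \<subseteq> fvs.span (F ` J)" using degree_bound by blast
  moreover have "fvs.span (F ` J) \<subseteq> quasi_poly {..N} \<mu> ` V"
    by (rule fvs.span_minimal[OF _ subspace_qp]) (auto simp: F_def J_def intro!: imageI tail_mem C)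
  ultimately have "fspan (basis_union lam N cs) = quasi_poly {..N} \<mu> ` V"
    unfolding bu fspan_eq_span[OF finite_imageI[OF finJ]] by (rule antisym[rotated])
  moreover have "lin_indep (basis_union lam N cs)" unfolding lin_indep_iff bu using ind finJ by simp
  moreover have "\<forall>c\<in>set cs. c \<in> V \<and> c \<noteq> (\<lambda>j. 0)" unfolding cs using C(1) nz by (metis imageE)
  ultimately show ?thesis unfolding \<mu>_def by blast
qed

end

subsection \<open>Trigonometric Darboux transforms\<close>

text \<open>One denominator for all coefficients lets a single factor clear the equation P u =
  0.\<close>

lemma trig_coeffs_common_denominator:
  assumes "trig_coeffs U a d"
  shows "\<exists>q p. q \<noteq> 0 \<and> (\<forall>i<d. \<forall>x\<in>U. poly q (exp x) \<noteq> 0 \<longrightarrow> a i x = poly (p i) (exp x) / poly q (exp x))"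
proof -
  have "\<forall>i. \<exists>p q. i < d \<longrightarrow> q \<noteq> 0 \<and> (\<forall>x\<in>U. poly q (exp x) \<noteq> 0 \<longrightarrow> a i x = poly p (exp x) / poly q (exp x))"
    using assms unfolding trig_coeffs_def by blast
  then obtain p q where pq: "\<And>i. i < d \<Longrightarrow> q i \<noteq> 0"
    "\<And>i x. i < d \<Longrightarrow> x \<in> U \<Longrightarrow> poly (q i) (exp x) \<noteq> 0 \<Longrightarrow> a i x = poly (p i) (exp x) / poly (q i) (exp x)"
    by metis
  show ?thesis
  proof (intro exI conjI allI impI ballI)
    show "(\<Prod>i<d. q i) \<noteq> 0" using pq(1) by simp
    fix i x assume i: "i < d" and x: "x \<in> U" "poly (\<Prod>i<d. q i) (exp x) \<noteq> 0"
    have "(\<Prod>i<d. q i) = q i * (\<Prod>k\<in>{..<d} - {i}. q k)" using i by (intro prod.remove) auto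
    then show "a i x = poly (p i * (\<Prod>k\<in>{..<d} - {i}. q k)) (exp x) / poly (\<Prod>i<d. q i) (exp x)"
      using pq(2)[OF i x(1)] x(2) by simp
  qed
qed

text \<open>exp is onto the nonzero complex numbers, so q(exp x) = 0 on an open set forces q to
  vanish off 0; the factor \<open>[:0, 1:]\<close> in the proof takes care of the point 0.\<close>

lemma poly_exp_nonzero_set:
  assumes U: "open U" "U \<noteq> {}" and q: "(q :: complex poly) \<noteq> 0"
  shows "open {x \<in> U. poly q (exp x) \<noteq> 0}" "{x \<in> U. poly q (exp x) \<noteq> 0} \<noteq> {}"
proof -
  have "{x \<in> U. poly q (exp x) \<noteq> 0} = U \<inter> (\<lambda>x. poly q (exp x)) -` (- {0})" by auto
  then show "open {x \<in> U. poly q (exp x) \<noteq> 0}" using U by (auto intro!: open_vimage continuous_intros)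
  show "{x \<in> U. poly q (exp x) \<noteq> 0} \<noteq> {}"
  proof
    assume "{x \<in> U. poly q (exp x) \<noteq> 0} = {}"
    moreover have "(\<lambda>x. poly q (exp x)) holomorphic_on UNIV" by (intro holomorphic_intros)
    ultimately have "poly q (exp x) = 0" for x using entire_eq_0[of "\<lambda>x. poly q (exp x)" U x] U by auto
    then have "poly (q * [:0, 1:]) z = 0" for z
      by (cases "z = 0") (auto simp: exp_Ln dest: spec[of _ "Ln z"], metis exp_Ln)
    then have "q * [:0, 1:] = 0" by (metis poly_all_0_iff_0)
    then show False using q by simp
  qed
qed

section \<open>The spectrum, grouped into classes modulo the integers\<close>

locale darboux_spectrum =
  fixes U :: "complex set" and f g :: "complex poly"
    and a b :: "nat \<Rightarrow> complex \<Rightarrow> complex" and d e n :: nat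
    and lam :: "nat \<Rightarrow> complex" and nr :: "nat \<Rightarrow> nat" and m :: "nat \<Rightarrow> nat \<Rightarrow> nat"
  assumes U: "open U" "connected U" "U \<noteq> {}"
    and D: "darboux_data U f g a d b e"
    and fg: "f * g = (\<Prod>r\<in>{1..n}. \<Prod>j\<in>{0..nr r}. [:of_nat j - lam r, 1:] ^ m r j)"
    and lam: "\<And>r s. r \<in> {1..n} \<Longrightarrow> s \<in> {1..n} \<Longrightarrow> r \<noteq> s \<Longrightarrow> lam r - lam s \<notin> \<int>"
begin

definition idx :: "(nat \<times> nat) set" where "idx = Sigma {1..n} (\<lambda>r. {..nr r})"

definition freq :: "nat \<times> nat \<Rightarrow> complex" where "freq i = lam (fst i) - of_nat (snd i)"

definition class_quasi_poly :: "nat \<Rightarrow> (nat \<Rightarrow> complex poly) \<Rightarrow> complex \<Rightarrow> complex" where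
  "class_quasi_poly r = quasi_poly {..nr r} (\<lambda>j. lam r - of_nat j)"

lemma finite_idx: "finite idx"
  by (simp add: idx_def)

text \<open>Frequencies of different classes differ by a non-integer, those within a class by a
  nonzero integer.\<close>

lemma inj_on_ev: "inj_on freq idx"
proof (rule inj_onI)
  fix i k assume ik: "i \<in> idx" "k \<in> idx" "freq i = freq k"
  then have "lam (fst i) - lam (fst k) = of_int (int (snd i) - int (snd k))"
    by (simp add: freq_def algebra_simps)
  then have "lam (fst i) - lam (fst k) \<in> \<int>" by (metis Ints_of_int)
  moreover have "fst i \<in> {1..n}" "fst k \<in> {1..n}" using ik by (auto simp: idx_def)
  ultimately have "fst i = fst k" using lam by blast
  moreover from this have "snd i = snd k" using ik(3) by (simp add: freq_def)
  ultimately show "i = k" by (simp add: prod_eq_iff)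
qed

lemma fg_idx: "f * g = (\<Prod>i\<in>idx. [:- freq i, 1:] ^ (case_prod m i))"
  unfolding fg idx_def by (simp add: prod.Sigma freq_def case_prod_beta atLeast0AtMost)

lemma a_holomorphic: "\<forall>i<d. a i holomorphic_on U"
  using D by (simp add: darboux_data_def)

lemma cq_holomorphic: "class_quasi_poly r c holomorphic_on S"
  by (simp add: class_quasi_poly_def qp_holomorphic)

lemma qp_idx: "quasi_poly idx freq p x = (\<Sum>r=1..n. class_quasi_poly r (\<lambda>j. p (r, j)) x)"
  by (simp add: quasi_poly_def class_quasi_poly_def idx_def freq_def sum.Sigma case_prod_beta)

lemma qp_idx_single:
  assumes "r \<in> {1..n}"
  shows "quasi_poly idx freq (\<lambda>i. if fst i = r then c (snd i) else 0) = class_quasi_poly r c"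
proof
  fix x
  have "quasi_poly idx freq (\<lambda>i. if fst i = r then c (snd i) else 0) x = (\<Sum>s=1..n. if s = r then class_quasi_poly r c x else 0)"
    unfolding qp_idx by (intro sum.cong) (auto simp: class_quasi_poly_def)
  then show "quasi_poly idx freq (\<lambda>i. if fst i = r then c (snd i) else 0) x = class_quasi_poly r c x" using assms by simp
qed

lemma kernel_qp:
  assumes "u holomorphic_on U" "\<And>x. x \<in> U \<Longrightarrow> dop a d u x = 0"
  shows "\<exists>p. (\<forall>i\<in>idx. p i = 0 \<or> degree (p i) < case_prod m i) \<and> (\<forall>x\<in>U. u x = quasi_poly idx freq p x)"
  by (rule darboux_kernel_qp[OF U D finite_idx inj_on_ev fg_idx assms])

text \<open>The joined bases of the summands form a basis of ker P, and d/dy sends each member to a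
  multiple of another member or to 0. That is the input required by
  \<open>trig_coeffs_if_pderiv_closed\<close>.\<close>

lemma trig_if_string_kernel:
  assumes adm: "\<And>r c. r \<in> {1..n} \<Longrightarrow> c \<in> set (cs r) \<Longrightarrow> adm_coeffs (nr r) (m r) c"
    and ind: "\<And>r. r \<in> {1..n} \<Longrightarrow> lin_indep (basis_union (lam r) (nr r) (cs r))"
    and ker: "ker_is_dsum U a d n (\<lambda>r. fspan (basis_union (lam r) (nr r) (cs r)))"
  shows "trig_coeffs U a d"
proof -
  define B where "B r = basis_union (lam r) (nr r) (cs r)" for r
  define BB where "BB = (\<Union>r\<in>{1..n}. B r)"
  have finB: "finite (B r)" for r by (simp add: B_def finite_basis_union)
  have finBB: "finite BB" by (simp add: BB_def finB)
  have span: "fspan (basis_union (lam r) (nr r) (cs r)) = fvs.span (B r)" for r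
    by (simp add: B_def fspan_eq_span finite_basis_union)
  have indB: "fvs.independent (B r)" if "r \<in> {1..n}" for r using ind[OF that] by (simp add: lin_indep_iff B_def)
  have ker1: "(u holomorphic_on U \<and> (\<forall>x\<in>U. dop a d u x = 0)) \<longleftrightarrow>
          (\<exists>v. (\<forall>r\<in>{1..n}. v r \<in> fvs.span (B r)) \<and> (\<forall>x\<in>U. u x = (\<Sum>r=1..n. v r x)))" for u
    using ker unfolding ker_is_dsum_def span by blast
  have ker2: "v r = (\<lambda>x. 0)" if "\<forall>r\<in>{1..n}. v r \<in> fvs.span (B r)" "\<forall>x\<in>U. (\<Sum>r=1..n. v r x) = 0" "r \<in> {1..n}" for v r
    using ker that unfolding ker_is_dsum_def span by blast
  have kerB: "dop a d u x = 0" if "r \<in> {1..n}" "u \<in> fvs.span (B r)" "x \<in> U" for r u x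
  proof -
    define v where "v s = (if s = r then u else 0)" for s
    have "u y = (\<Sum>s=1..n. v s y)" for y
    proof -
      have "(\<Sum>s=1..n. v s y) = (\<Sum>s=1..n. if s = r then u y else 0)"
        by (intro sum.cong) (auto simp: v_def)
      then show ?thesis using that(1) by simp
    qed
    moreover have "v s \<in> fvs.span (B s)" for s using that(2) by (simp add: v_def fvs.span_zero)
    ultimately have "u holomorphic_on U \<and> (\<forall>x\<in>U. dop a d u x = 0)"
      by (intro iffD2[OF ker1] exI[of _ v]) blast
    then show ?thesis using that(3) by blast
  qed
  have disj: "B r \<inter> B s = {}" if "r \<in> {1..n}" "s \<in> {1..n}" "r \<noteq> s" for r s
  proof (rule ccontr)
    assume "B r \<inter> B s \<noteq> {}"
    then obtain u where u: "u \<in> B r" "u \<in> B s" by blast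
    \<comment> \<open>A common member u would put u and -u into two different summands with sum
      0.\<close>
    define v where "v k = (if k = r then u else if k = s then fun_scale (- 1) u else (\<lambda>_. 0))" for k
    have "\<forall>k\<in>{1..n}. v k \<in> fvs.span (B k)"
      using u fvs.span_zero by (auto simp: v_def zero_fun_def[symmetric] intro: fvs.span_base fvs.span_scale fvs.span_neg)
    moreover have "(\<Sum>k=1..n. v k x) = 0" for x
    proof -
      have "(\<Sum>k=1..n. v k x) = (\<Sum>k=1..n. (if k = r then u x else 0) - (if k = s then u x else 0))"
        using that(3) by (intro sum.cong) (auto simp: v_def fun_scale_def)
      then show ?thesis using that by (simp add: sum_subtractf)
    qed
    ultimately have "v r = (\<lambda>x. 0)" using ker2 that(1) by blast
    then have "u = 0" by (simp add: v_def zero_fun_def)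
    then show False using u(1) indB[OF that(1)] fvs.dependent_zero by blast
  qed
  have indBB: "fvs.independent BB"
    unfolding fvs_indep_iff[OF finBB]
  proof (intro allI impI)
    fix w assume w: "\<forall>x. (\<Sum>u\<in>BB. w u * u x) = 0"
    define v where "v r = (\<lambda>x. \<Sum>u\<in>B r. w u * u x)" for r
    have "\<forall>r\<in>{1..n}. v r \<in> fvs.span (B r)" using fvs_span_iff[OF finB] by (auto simp: v_def)
    moreover have "(\<Sum>r=1..n. v r x) = (\<Sum>u\<in>BB. w u * u x)" for x
      unfolding v_def BB_def using finB disj by (intro sum.UNION_disjoint[symmetric]) auto
    moreover from this have "\<forall>x\<in>U. (\<Sum>r=1..n. v r x) = 0" using w by simp
    ultimately have v0: "v r = (\<lambda>x. 0)" if "r \<in> {1..n}" for r using ker2[OF _ _ that] by blast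
    have "\<forall>u\<in>B r. w u = 0" if r: "r \<in> {1..n}" for r
    proof -
      have "(\<Sum>u\<in>B r. w u * u x) = 0" for x using fun_cong[OF v0[OF r], of x] by (simp add: v_def)
      then show ?thesis using indB[OF r] unfolding fvs_indep_iff[OF finB] by blast
    qed
    then show "\<forall>u\<in>BB. w u = 0" by (auto simp: BB_def)
  qed
  have repr: "\<exists>r c l. r \<in> {1..n} \<and> c \<in> set (cs r) \<and> u = class_quasi_poly r (taylor_coeff l c)" if uBB: "u \<in> BB" for u
  proof -
    obtain r c where "r \<in> {1..n}" "c \<in> set (cs r)" "u \<in> block (lam r) (nr r) c"
      using uBB by (auto simp: BB_def B_def basis_union_def)
    then show ?thesis unfolding block_eq class_quasi_poly_def by blast
  qed
  have tail_mem: "class_quasi_poly r (taylor_coeff l c) \<in> fvs.span (B r)" if "r \<in> {1..n}" "c \<in> set (cs r)" for r c l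
  proof (cases "l \<le> l0 (nr r) c")
    case True
    then have "class_quasi_poly r (taylor_coeff l c) \<in> B r" using that by (auto simp: B_def basis_union_def block_eq class_quasi_poly_def)
    then show ?thesis by (rule fvs.span_base)
  next
    case False
    then have "class_quasi_poly r (taylor_coeff l c) = 0"
      by (auto simp: class_quasi_poly_def quasi_poly_def tail_eq_0 fun_eq_iff)
    then show ?thesis by (simp add: fvs.span_zero)
  qed
  \<comment> \<open>This makes the system square: as many basis functions as unknown coefficients of
    P.\<close>
  have "card BB = d"
  proof (rule darboux_kernel_card[OF U D finite_idx inj_on_ev fg_idx finBB indBB])
    show "u holomorphic_on UNIV" if "u \<in> BB" for u using repr[OF that] cq_holomorphic by auto
    show "dop a d u x = 0" if "u \<in> BB" "x \<in> U" for u x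
    proof -
      obtain r where "r \<in> {1..n}" "u \<in> B r" using \<open>u \<in> BB\<close> by (auto simp: BB_def)
      then show ?thesis using kerB fvs.span_base \<open>x \<in> U\<close> by blast
    qed
    show "\<exists>w. \<forall>x\<in>U. u x = (\<Sum>v\<in>BB. w v * v x)" if "u holomorphic_on U" "\<And>x. x \<in> U \<Longrightarrow> dop a d u x = 0" for u
    proof -
      obtain v where v: "\<forall>r\<in>{1..n}. v r \<in> fvs.span (B r)" "\<forall>x\<in>U. u x = (\<Sum>r=1..n. v r x)"
        using ker1[of u] \<open>u holomorphic_on U\<close> \<open>\<And>x. x \<in> U \<Longrightarrow> dop a d u x = 0\<close> by blast
      have "(\<Sum>r=1..n. v r) \<in> fvs.span BB"
      proof (rule fvs.span_sum)
        fix r assume r: "r \<in> {1..n}"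
        then have "fvs.span (B r) \<subseteq> fvs.span BB" by (intro fvs.span_mono) (auto simp: BB_def)
        then show "v r \<in> fvs.span BB" using v(1) r by blast
      qed
      then obtain w where "\<And>x. (\<Sum>r=1..n. v r) x = (\<Sum>u\<in>BB. w u * u x)" using fvs_span_iff[OF finBB] by blast
      moreover have "(\<Sum>r=1..n. v r) x = (\<Sum>r=1..n. v r x)" for x
        using sum_scl_apply[of "\<lambda>_. 1" v "{1..n}" x] by (simp add: fun_scale_def)
      ultimately show ?thesis using v(2) by (intro exI[of _ w]) simp
    qed
  qed
  then obtain h where h: "bij_betw h {..<d} BB"
    using ex_bij_betw_nat_finite[OF finBB] by (auto simp: atLeast0LessThan)
  have hBB: "h k \<in> BB" if "k < d" for k using h that by (auto simp: bij_betw_def)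
  have "\<exists>R C L. \<forall>k<d. R k \<in> {1..n} \<and> C k \<in> set (cs (R k)) \<and> h k = class_quasi_poly (R k) (taylor_coeff (L k) (C k))"
    using repr[OF hBB] by metis
  then obtain R C L where RCL: "\<And>k. k < d \<Longrightarrow> R k \<in> {1..n}" "\<And>k. k < d \<Longrightarrow> C k \<in> set (cs (R k))"
    "\<And>k. k < d \<Longrightarrow> h k = class_quasi_poly (R k) (taylor_coeff (L k) (C k))"
    by blast
  define p where "p k i = (if fst i = R k then taylor_coeff (L k) (C k) (snd i) else 0)" for k i
  have hp: "quasi_poly idx freq (p k) = h k" if "k < d" for k
    using qp_idx_single[OF RCL(1)[OF that]] RCL(3)[OF that] by (simp add: p_def[abs_def])
  \<comment> \<open>lam r - nr r is the last frequency of the class r. Factoring out its exponential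
    leaves exp x to the powers nr r - j, which are natural numbers.\<close>
  show ?thesis
  proof (rule trig_coeffs_if_pderiv_closed[OF U a_holomorphic finite_idx inj_on_ev,
        of p "\<lambda>k. lam (R k) - of_nat (nr (R k))" "\<lambda>k i. nr (R k) - snd i"])
    fix k i assume "k < d" "i \<in> idx" "p k i \<noteq> 0"
    then show "freq i = lam (R k) - of_nat (nr (R k)) + of_nat (nr (R k) - snd i)"
      by (auto simp: p_def freq_def idx_def of_nat_diff split: if_splits)
  next
    fix k x l assume k: "k < d" and x: "x \<in> U"
    have "quasi_poly idx freq (\<lambda>i. (pderiv ^^ l) (p k i))
        = quasi_poly idx freq (\<lambda>i. if fst i = R k then (pderiv ^^ l) (taylor_coeff (L k) (C k) (snd i)) else 0)"
    proof (rule qp_cong)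
      have "(pderiv ^^ l) 0 = (0 :: complex poly)" by (induction l) auto
      then show "(pderiv ^^ l) (p k i) = (if fst i = R k then (pderiv ^^ l) (taylor_coeff (L k) (C k) (snd i)) else 0)" for i
        by (simp add: p_def)
    qed
    also have "\<dots> = class_quasi_poly (R k) (\<lambda>j. (pderiv ^^ l) (taylor_coeff (L k) (C k) j))"
      by (rule qp_idx_single[OF RCL(1)[OF k]])
    also have "\<dots> = fun_scale (fact (l + L k) / fact (L k)) (class_quasi_poly (R k) (taylor_coeff (l + L k) (C k)))"
      by (simp add: fun_eq_iff fun_scale_def class_quasi_poly_def qp_smult higher_pderiv_tail)
    also have "\<dots> \<in> fvs.span (B (R k))"
      by (intro fvs.span_scale tail_mem RCL k)
    finally show "dop a d (quasi_poly idx freq (\<lambda>i. (pderiv ^^ l) (p k i))) x = 0"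
      using kerB[OF RCL(1)[OF k] _ x] by blast
  next
    fix w assume w: "\<And>x. (\<Sum>k<d. w k * quasi_poly idx freq (p k) x) = 0"
    define hi where "hi = inv_into {..<d} h"
    have hi: "hi (h k) = k" if "k < d" for k using h that by (simp add: hi_def bij_betw_def)
    have "(\<Sum>u\<in>BB. w (hi u) * u x) = 0" for x
    proof -
      have "(\<Sum>u\<in>BB. w (hi u) * u x) = (\<Sum>k<d. w (hi (h k)) * h k x)"
        by (rule sum.reindex_bij_betw[OF h, symmetric])
      also have "\<dots> = (\<Sum>k<d. w k * quasi_poly idx freq (p k) x)" by (intro sum.cong) (auto simp: hi hp)
      finally show ?thesis using w by simp
    qed
    then have "\<forall>u\<in>BB. w (hi u) = 0"
      using indBB[unfolded fvs_indep_iff[OF finBB], THEN spec, of "\<lambda>u. w (hi u)"] by blast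
    then show "\<forall>k<d. w k = 0" using hBB hi by metis
  qed
qed

text \<open>The coefficients of P are periodic, so at x + 2 pi i k a kernel element satisfies the
  equation of the point x; the resulting exponential-polynomial sequence in k vanishes termwise.\<close>
lemma kernel_splits:
  assumes a: "trig_coeffs U a d" and u: "\<And>x. x \<in> U \<Longrightarrow> dop a d (quasi_poly idx freq p) x = 0"
    and r: "r \<in> {1..n}" and x: "x \<in> U"
  shows "shift_poly (\<lambda>i. mcoef a d i x) d {..nr r} (\<lambda>j. lam r - of_nat j) x (\<lambda>j. p (r, j)) = 0"
proof -
  define S where "S r x = shift_poly (\<lambda>i. mcoef a d i x) d {..nr r} (\<lambda>j. lam r - of_nat j) x (\<lambda>j. p (r, j))" for r x
  define T :: complex where "T = 2 * of_real pi * \<i>"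
  have T: "exp T = 1" "T \<noteq> 0" by (simp_all add: T_def exp_two_pi_i)
  define rho where "rho r = exp (lam r * T)" for r
  have rho: "inj_on rho {1..n}"
  proof (rule inj_onI, rule ccontr)
    fix r s assume rs: "r \<in> {1..n}" "s \<in> {1..n}" "rho r = rho s" "r \<noteq> s"
    then obtain k :: int where "lam r * T = lam s * T + (of_int (2 * k) * pi) * \<i>"
      unfolding rho_def exp_eq by blast
    then have "(lam r - lam s - of_int k) * T = 0" by (simp add: T_def algebra_simps)
    then have "lam r - lam s = of_int k" using T by simp
    then show False using lam[OF rs(1,2,4)] by simp
  qed
  obtain q pp where q: "q \<noteq> 0" and pp: "\<And>i x. i < d \<Longrightarrow> x \<in> U \<Longrightarrow> poly q (exp x) \<noteq> 0 \<Longrightarrow>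
      a i x = poly (pp i) (exp x) / poly q (exp x)"
    using trig_coeffs_common_denominator[OF a] by blast
  define U' where "U' = {x \<in> U. poly q (exp x) \<noteq> 0}"
  have U': "open U'" "U' \<noteq> {}" "U' \<subseteq> U" using poly_exp_nonzero_set[OF U(1,3) q] by (auto simp: U'_def)
  \<comment> \<open>The coefficients of P after clearing \<open>q\<close>: entire and invariant
    under translation by \<open>T\<close>, also outside \<open>U\<close>.\<close>
  define C where "C i x = (if i < d then poly (pp i) (exp x) else poly q (exp x))" for i x
  have C: "C i x = poly q (exp x) * mcoef a d i x" if "x \<in> U'" for i x
    using pp[of i x] that by (auto simp: C_def mcoef_def U'_def)
  define G where "G x = (\<Sum>i\<le>d. C i x * (deriv ^^ i) (quasi_poly idx freq p) x)" for x
  have "C i holomorphic_on UNIV" for i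
  proof (cases "i < d")
    case True
    then have "C i = (\<lambda>x. poly (pp i) (exp x))" by (simp add: C_def[abs_def])
    then show ?thesis by (simp add: holomorphic_intros)
  next
    case False
    then have "C i = (\<lambda>x. poly q (exp x))" by (simp add: C_def[abs_def])
    then show ?thesis by (simp add: holomorphic_intros)
  qed
  then have "G holomorphic_on UNIV" unfolding G_def[abs_def] higher_deriv_qp
    by (intro holomorphic_on_sum holomorphic_on_mult qp_holomorphic)
  moreover have "G x = 0" if "x \<in> U'" for x
  proof -
    have "G x = poly q (exp x) * dop a d (quasi_poly idx freq p) x"
      by (simp add: G_def C[OF that] dop_eq_mcoef sum_distrib_left mult.assoc)
    then show ?thesis using u U' that by auto
  qed
  \<comment> \<open>This carries the equation to the points x + k T, which may lie outside
    \<open>U\<close>.\<close>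
  ultimately have G: "G x = 0" for x using entire_eq_0 U' by blast
  have S0: "S r x = 0" if x: "x \<in> U'" for x
  proof -
    \<comment> \<open>In the equation at x + k T the operator is still the one at x, while the
      coefficient polynomials are evaluated at x + k T, that is, shifted by s = k T.\<close>
    have "(\<Sum>r\<in>{1..n}. rho r ^ k * poly (S r x \<circ>\<^sub>p [:0, T:]) (of_nat k)) = 0" for k
    proof -
      define y where "y = x + of_nat k * T"
      have "exp y = exp x" by (simp add: y_def exp_add exp_of_nat_mult T)
      then have "C i y = C i x" for i by (simp add: C_def)
      then have Cy: "C i y = poly q (exp x) * mcoef a d i x" for i using C[OF x, of i] by simp
      \<comment> \<open>Frequencies of a class differ by integers and exp T = 1, so the translation
        multiplies all exponentials of the class by the same factor.\<close>
      have ex: "exp ((lam r - of_nat j) * y) = rho r ^ k * exp ((lam r - of_nat j) * x)" for r j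
      proof -
        have "(lam r - of_nat j) * y + of_nat (j * k) * T = (lam r - of_nat j) * x + of_nat k * (lam r * T)"
          by (simp add: y_def algebra_simps)
        then have "exp ((lam r - of_nat j) * y) * exp (of_nat (j * k) * T)
            = exp ((lam r - of_nat j) * x) * exp (of_nat k * (lam r * T))"
          by (simp only: exp_add[symmetric])
        then show ?thesis by (simp only: exp_of_nat_mult T rho_def) (simp add: mult.commute)
      qed
      have dq: "(deriv ^^ i) (quasi_poly idx freq p) y = (\<Sum>r\<in>{1..n}. \<Sum>j\<le>nr r.
          poly ((twisted_pderiv (lam r - of_nat j) ^^ i) (p (r, j))) y * (rho r ^ k * exp ((lam r - of_nat j) * x)))" for i
        unfolding higher_deriv_qp qp_idx by (simp add: class_quasi_poly_def quasi_poly_def freq_def ex)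
      have "0 = G y" by (simp add: G)
      also have "\<dots> = poly q (exp x) * (\<Sum>i\<le>d. mcoef a d i x * (deriv ^^ i) (quasi_poly idx freq p) y)"
        by (simp add: G_def Cy sum_distrib_left mult.assoc)
      also have "(\<Sum>i\<le>d. mcoef a d i x * (deriv ^^ i) (quasi_poly idx freq p) y)
          = (\<Sum>i\<le>d. \<Sum>r\<in>{1..n}. \<Sum>j\<le>nr r. mcoef a d i x *
              (poly ((twisted_pderiv (lam r - of_nat j) ^^ i) (p (r, j))) y * (rho r ^ k * exp ((lam r - of_nat j) * x))))"
        unfolding dq sum_distrib_left ..
      also have "\<dots> = (\<Sum>r\<in>{1..n}. \<Sum>i\<le>d. \<Sum>j\<le>nr r. mcoef a d i x *
              (poly ((twisted_pderiv (lam r - of_nat j) ^^ i) (p (r, j))) y * (rho r ^ k * exp ((lam r - of_nat j) * x))))"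
        by (rule sum.swap)
      also have "\<dots> = (\<Sum>r\<in>{1..n}. rho r ^ k * poly (S r x \<circ>\<^sub>p [:0, T:]) (of_nat k))"
        unfolding S_def shift_poly_def poly_pcompose poly_sum poly_smult sum_distrib_left
        by (intro sum.cong refl) (simp add: y_def mult_ac)
      finally show ?thesis using x by (simp add: U'_def)
    qed
    then have "S r x \<circ>\<^sub>p [:0, T:] = 0"
      using exp_poly_sequence_eq_0[OF _ rho, of "\<lambda>r. S r x \<circ>\<^sub>p [:0, T:]" r] r by (simp add: rho_def)
    then show ?thesis using T by (simp add: pcompose_eq_0_iff)
  qed
  \<comment> \<open>Points of \<open>U\<close> with q(exp x) = 0 are still missing. For each fixed s
    the value is holomorphic in x, so it vanishes there too.\<close>
  have "poly (S r x) s = 0" for s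
    unfolding S_def poly_shift_poly
  proof (rule holomorphic_eq_0_if_open_zeros[OF _ U(1,2) U' _ x])
    show "dop a d (quasi_poly {..nr r} (\<lambda>j. lam r - of_nat j) (\<lambda>j. p (r, j) \<circ>\<^sub>p [:s, 1:])) holomorphic_on U"
      by (rule dop_holomorphic[OF U(1) qp_holomorphic a_holomorphic])
    fix y assume "y \<in> U'"
    then have "poly (S r y) s = 0" by (simp add: S0)
    then show "dop a d (quasi_poly {..nr r} (\<lambda>j. lam r - of_nat j) (\<lambda>j. p (r, j) \<circ>\<^sub>p [:s, 1:])) y = 0"
      unfolding S_def poly_shift_poly .
  qed
  then show ?thesis unfolding S_def by (metis poly_all_0_iff_0)
qed

text \<open>The coefficient side of K_r. Zero entries beyond \<open>nr r\<close> make tuple and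
  function determine each other; the degree conditions place the function in W_r.\<close>

definition kernel_family :: "nat \<Rightarrow> (nat \<Rightarrow> complex poly) set" where
  "kernel_family r = {c. (\<forall>j. nr r < j \<longrightarrow> c j = 0) \<and> (\<forall>j\<le>nr r. c j = 0 \<or> degree (c j) < m r j) \<and>
      (\<forall>x\<in>U. dop a d (class_quasi_poly r c) x = 0)}"

text \<open>Value and derivative at s = 0 of the vanishing polynomial of
  \<open>kernel_splits\<close>: the first separates the classes, the second gives stability under
  d/dy.\<close>

lemma kernel_component:
  assumes a: "trig_coeffs U a d" and u: "\<And>x. x \<in> U \<Longrightarrow> dop a d (quasi_poly idx freq p) x = 0"
    and r: "r \<in> {1..n}" and x: "x \<in> U"
  shows "dop a d (class_quasi_poly r (\<lambda>j. p (r, j))) x = 0" "dop a d (class_quasi_poly r (\<lambda>j. pderiv (p (r, j)))) x = 0"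
proof -
  have *: "dop a d (class_quasi_poly r c) x = poly (shift_poly (\<lambda>i. mcoef a d i x) d {..nr r} (\<lambda>j. lam r - of_nat j) x c) 0" for c
    by (simp add: poly_shift_poly class_quasi_poly_def pcompose_idR)
  have 0: "shift_poly (\<lambda>i. mcoef a d i x) d {..nr r} (\<lambda>j. lam r - of_nat j) x (\<lambda>j. p (r, j)) = 0"
    using a u r x by (rule kernel_splits)
  show "dop a d (class_quasi_poly r (\<lambda>j. p (r, j))) x = 0"
    unfolding * 0 by simp
  show "dop a d (class_quasi_poly r (\<lambda>j. pderiv (p (r, j)))) x = 0"
    unfolding * pderiv_shift_poly[symmetric] 0 by simp
qed

text \<open>Closure under d/dy is the clause that rests on P being trigonometric. The degree bound
  is crude; its \<open>Suc\<close> makes the strict inequality hold for zero entries as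
  well.\<close>

lemma poly_family_space_Kr:
  assumes a: "trig_coeffs U a d" and r: "r \<in> {1..n}"
  shows "poly_family_space (nr r) (Suc (\<Sum>j\<le>nr r. m r j)) (kernel_family r)"
proof
  show "c j = 0" if "c \<in> kernel_family r" "nr r < j" for c j using that by (simp add: kernel_family_def)
  show "degree (c j) < Suc (\<Sum>j\<le>nr r. m r j)" if c: "c \<in> kernel_family r" for c j
  proof (cases "j \<le> nr r")
    case True
    then have "m r j \<le> (\<Sum>j\<le>nr r. m r j)" by (intro member_le_sum) auto
    moreover have "c j = 0 \<or> degree (c j) < m r j" using c True by (simp add: kernel_family_def)
    ultimately show ?thesis by auto
  next
    case False
    then show ?thesis using c by (simp add: kernel_family_def)
  qed
  have lin: "dop a d (class_quasi_poly r (\<lambda>j. \<Sum>k\<in>A. smult (w k) (c k j))) x = 0"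
    if "\<And>k. k \<in> A \<Longrightarrow> c k \<in> kernel_family r" "x \<in> U" for A :: "nat set" and w c x
  proof -
    have "class_quasi_poly r (\<lambda>j. \<Sum>k\<in>A. smult (w k) (c k j)) = (\<lambda>x. \<Sum>k\<in>A. w k * class_quasi_poly r (c k) x)"
      by (simp add: class_quasi_poly_def qp_lin_comb)
    then show ?thesis using that dop_lin_comb[OF U(1) that(2), of A "\<lambda>k. class_quasi_poly r (c k)" a d w]
      by (simp add: cq_holomorphic kernel_family_def)
  qed
  show z: "(\<lambda>j. 0) \<in> kernel_family r" using lin[of "{}"] by (simp add: kernel_family_def)
  show "(\<lambda>j. c j + c' j) \<in> kernel_family r" if c: "c \<in> kernel_family r" "c' \<in> kernel_family r" for c c'
  proof -
    have "dop a d (class_quasi_poly r (\<lambda>j. c j + c' j)) x = 0" if "x \<in> U" for x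
      using lin[of "{0, 1}" "\<lambda>k. if k = 0 then c else c'" x "\<lambda>_. 1"] c that by simp
    moreover have "c j + c' j = 0 \<or> degree (c j + c' j) < m r j" if "j \<le> nr r" for j
    proof -
      have "c j = 0 \<or> degree (c j) < m r j" "c' j = 0 \<or> degree (c' j) < m r j" using c that by (auto simp: kernel_family_def)
      then show ?thesis using degree_add_less[of "c j" "m r j" "c' j"] by auto
    qed
    ultimately show ?thesis using c by (simp add: kernel_family_def)
  qed
  show "(\<lambda>j. smult k (c j)) \<in> kernel_family r" if c: "c \<in> kernel_family r" for c k
  proof -
    have "dop a d (class_quasi_poly r (\<lambda>j. smult k (c j))) x = 0" if "x \<in> U" for x
      using lin[of "{0}" "\<lambda>_. c" x "\<lambda>_. k"] c that by simp
    then show ?thesis using c by (auto simp: kernel_family_def)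
  qed
  show "(\<lambda>j. pderiv (c j)) \<in> kernel_family r" if c: "c \<in> kernel_family r" for c
  proof -
    define p where "p i = (if fst i = r then c (snd i) else 0)" for i :: "nat \<times> nat"
    have "dop a d (quasi_poly idx freq p) x = 0" if "x \<in> U" for x
      using qp_idx_single[OF r, of c] c that by (simp add: p_def[abs_def] kernel_family_def)
    then have "dop a d (class_quasi_poly r (\<lambda>j. pderiv (c j))) x = 0" if "x \<in> U" for x
      using kernel_component(2)[OF a _ r that, of p] by (simp add: p_def)
    moreover have "pderiv (c j) = 0 \<or> degree (pderiv (c j)) < m r j" if "j \<le> nr r" for j
    proof -
      have "c j = 0 \<or> degree (c j) < m r j" using c that by (simp add: kernel_family_def)
      then show ?thesis by (auto simp: degree_pderiv)
    qed
    ultimately show ?thesis using c by (simp add: kernel_family_def)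
  qed
qed

text \<open>K_r consists of the functions with coefficients in \<open>kernel_family r\<close>, and
  \<open>ex_string_basis\<close> supplies its strings. \<open>kernel_component\<close> splits ker P
  into the K_r, and uniqueness of quasi-polynomial coefficients makes the sum direct.\<close>

lemma string_kernel_if_trig:
  assumes a: "trig_coeffs U a d"
  shows "\<exists>cs. (\<forall>r\<in>{1..n}. \<forall>c\<in>set (cs r). adm_coeffs (nr r) (m r) c) \<and>
        (\<forall>r\<in>{1..n}. lin_indep (basis_union (lam r) (nr r) (cs r))) \<and>
        ker_is_dsum U a d n (\<lambda>r. fspan (basis_union (lam r) (nr r) (cs r)))"
proof -
  have "\<exists>cs. (\<forall>c\<in>set cs. c \<in> kernel_family r \<and> c \<noteq> (\<lambda>j. 0)) \<and> lin_indep (basis_union (lam r) (nr r) cs)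
      \<and> fspan (basis_union (lam r) (nr r) cs) = class_quasi_poly r ` kernel_family r" if "r \<in> {1..n}" for r
    unfolding class_quasi_poly_def by (rule poly_family_space.ex_string_basis[OF poly_family_space_Kr[OF a that]])
  then have "\<exists>cs. \<forall>r\<in>{1..n}. (\<forall>c\<in>set (cs r). c \<in> kernel_family r \<and> c \<noteq> (\<lambda>j. 0))
      \<and> lin_indep (basis_union (lam r) (nr r) (cs r)) \<and> fspan (basis_union (lam r) (nr r) (cs r)) = class_quasi_poly r ` kernel_family r"
    by (intro bchoice ballI)
  then obtain cs where cs: "\<And>r c. r \<in> {1..n} \<Longrightarrow> c \<in> set (cs r) \<Longrightarrow> c \<in> kernel_family r \<and> c \<noteq> (\<lambda>j. 0)"
    "\<And>r. r \<in> {1..n} \<Longrightarrow> lin_indep (basis_union (lam r) (nr r) (cs r))"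
    "\<And>r. r \<in> {1..n} \<Longrightarrow> fspan (basis_union (lam r) (nr r) (cs r)) = class_quasi_poly r ` kernel_family r"
    by blast
  have "adm_coeffs (nr r) (m r) c" if "r \<in> {1..n}" "c \<in> set (cs r)" for r c
  proof -
    have c: "c \<in> kernel_family r" "c \<noteq> (\<lambda>j. 0)" using cs(1)[OF that] by auto
    then obtain j where "c j \<noteq> 0" by auto
    moreover from this have "j \<le> nr r" using c(1) by (auto simp: kernel_family_def not_less[symmetric])
    ultimately show ?thesis using c(1) unfolding adm_coeffs_def kernel_family_def by blast
  qed
  moreover have "ker_is_dsum U a d n (\<lambda>r. fspan (basis_union (lam r) (nr r) (cs r)))"
    unfolding ker_is_dsum_def
  proof (intro conjI allI iffI impI)
    fix u assume u: "u holomorphic_on U \<and> (\<forall>x\<in>U. dop a d u x = 0)"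
    then obtain p where p: "\<forall>i\<in>idx. p i = 0 \<or> degree (p i) < case_prod m i" "\<forall>x\<in>U. u x = quasi_poly idx freq p x"
      using kernel_qp[of u] by blast
    have ker: "dop a d (quasi_poly idx freq p) x = 0" if "x \<in> U" for x
      using dop_cong[OF U(1) that, of u "quasi_poly idx freq p" a d] u p(2) that by simp
    have "class_quasi_poly r (\<lambda>j. p (r, j)) \<in> class_quasi_poly r ` kernel_family r" if r: "r \<in> {1..n}" for r
    proof (rule image_eqI)
      show "class_quasi_poly r (\<lambda>j. p (r, j)) = class_quasi_poly r (\<lambda>j. if j \<le> nr r then p (r, j) else 0)"
        unfolding class_quasi_poly_def by (rule qp_cong) simp
      then show "(\<lambda>j. if j \<le> nr r then p (r, j) else 0) \<in> kernel_family r"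
        using kernel_component(1)[OF a ker r] p(1) r by (auto simp: kernel_family_def idx_def)
    qed
    then have "\<forall>r\<in>{1..n}. class_quasi_poly r (\<lambda>j. p (r, j)) \<in> fspan (basis_union (lam r) (nr r) (cs r))"
      using cs(3) by blast
    moreover have "\<forall>x\<in>U. u x = (\<Sum>r=1..n. class_quasi_poly r (\<lambda>j. p (r, j)) x)" using p(2) by (simp add: qp_idx)
    ultimately show "\<exists>v. (\<forall>r\<in>{1..n}. v r \<in> fspan (basis_union (lam r) (nr r) (cs r))) \<and> (\<forall>x\<in>U. u x = (\<Sum>r=1..n. v r x))"
      by (intro exI[of _ "\<lambda>r. class_quasi_poly r (\<lambda>j. p (r, j))"]) blast
  next
    fix u assume "\<exists>v. (\<forall>r\<in>{1..n}. v r \<in> fspan (basis_union (lam r) (nr r) (cs r))) \<and> (\<forall>x\<in>U. u x = (\<Sum>r=1..n. v r x))"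
    then obtain v where "\<forall>r\<in>{1..n}. v r \<in> fspan (basis_union (lam r) (nr r) (cs r))"
      "\<forall>x\<in>U. u x = (\<Sum>r=1..n. v r x)" by blast
    then have v: "\<And>r. r \<in> {1..n} \<Longrightarrow> v r \<in> class_quasi_poly r ` kernel_family r" "\<And>x. x \<in> U \<Longrightarrow> u x = (\<Sum>r=1..n. v r x)"
      using cs(3) by blast+
    have hol: "v r holomorphic_on U" if "r \<in> {1..n}" for r using v(1)[OF that] cq_holomorphic by auto
    have "(\<lambda>x. \<Sum>r=1..n. v r x) holomorphic_on U" using hol by (intro holomorphic_on_sum)
    then show hu: "u holomorphic_on U" using v(2) by (metis (mono_tags, lifting) holomorphic_cong)
    show "\<forall>x\<in>U. dop a d u x = 0"
    proof
      fix x assume x: "x \<in> U"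
      have "dop a d u x = dop a d (\<lambda>x. \<Sum>r\<in>{1..n}. 1 * v r x) x"
        using v(2) by (intro dop_cong[OF U(1) x hu]) simp
      also have "\<dots> = (\<Sum>r\<in>{1..n}. 1 * dop a d (v r) x)" by (rule dop_lin_comb[OF U(1) x hol])
      also have "\<dots> = 0"
      proof (intro sum.neutral ballI)
        fix r assume "r \<in> {1..n}"
        then obtain c where "c \<in> kernel_family r" "v r = class_quasi_poly r c" using v(1) by blast
        then show "1 * dop a d (v r) x = 0" using x by (simp add: kernel_family_def)
      qed
      finally show "dop a d u x = 0" .
    qed
  next
    fix v assume v: "(\<forall>r\<in>{1..n}. v r \<in> fspan (basis_union (lam r) (nr r) (cs r))) \<and> (\<forall>x\<in>U. (\<Sum>r=1..n. v r x) = 0)"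
    then have "\<forall>r\<in>{1..n}. \<exists>c. v r = class_quasi_poly r c" using cs(3) by auto
    then obtain c where c: "\<And>r. r \<in> {1..n} \<Longrightarrow> v r = class_quasi_poly r (c r)" by metis
    have "quasi_poly idx freq (\<lambda>i. c (fst i) (snd i)) x = 0" if "x \<in> U" for x
      using v c that by (simp add: qp_idx)
    then have "c r j = 0" if "r \<in> {1..n}" "j \<le> nr r" for r j
      using qp_eq_0_imp[OF finite_idx inj_on_ev U(1,3), of "\<lambda>i. c (fst i) (snd i)" "(r, j)"] that by (simp add: idx_def)
    then show "\<forall>r\<in>{1..n}. v r = (\<lambda>x. 0)" using c by (simp add: class_quasi_poly_def quasi_poly_def fun_eq_iff)
  qed
  ultimately show ?thesis using cs(2) by blast
qed

end

theorem theorem3p3: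
  fixes U :: "complex set" and f g :: "complex poly"
    and a b :: "nat \<Rightarrow> complex \<Rightarrow> complex" and d e n :: nat
    and lam :: "nat \<Rightarrow> complex" and nr :: "nat \<Rightarrow> nat" and m :: "nat \<Rightarrow> nat \<Rightarrow> nat"
  assumes "open U" and "connected U" and "U \<noteq> {}"
    and "darboux_data U f g a d b e"
    and "f * g = (\<Prod>r\<in>{1..n}. \<Prod>j\<in>{0..nr r}. [:of_nat j - lam r, 1:] ^ m r j)"
    and "\<forall>r\<in>{1..n}. \<forall>s\<in>{1..n}. r \<noteq> s \<longrightarrow> lam r \<noteq> lam s \<and> lam r - lam s \<notin> \<int>"
    and "\<forall>r\<in>{1..n}. 0 < m r 0"
  shows "(trig_coeffs U a d \<and> trig_coeffs U b e) \<longleftrightarrow>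
    (\<exists>cs :: nat \<Rightarrow> (nat \<Rightarrow> complex poly) list.
        (\<forall>r\<in>{1..n}. \<forall>c\<in>set (cs r). adm_coeffs (nr r) (m r) c) \<and>
        (\<forall>r\<in>{1..n}. lin_indep (basis_union (lam r) (nr r) (cs r))) \<and>
        ker_is_dsum U a d n (\<lambda>r. fspan (basis_union (lam r) (nr r) (cs r))))"
proof -
  interpret darboux_spectrum U f g a b d e n lam nr m
    using assms by unfold_locales auto
  show ?thesis
    using string_kernel_if_trig trig_if_string_kernel trig_coeffs_left_factor[OF U(1) D] by blast
qed

end
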